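(* Let $n\ge 3$ and let $(M,g)$ be a connected $n$-dimensional pseudo-Riemannian manifold of arbitrary index $q$ ($0\le q\le n$). Suppose that $(M,g)$ is conformally flat and generalized Ricci recurrent, i.e. $M$ is non-flat and its Ricci tensor $R_{jl}$ satisfies $$\nabla_i R_{jl}=A_iR_{jl}+B_ig_{jl}$$ for some non-zero $1$-forms $A_i$ and $B_i$ on $M$. Then $(M,g)$ is an Einstein manifold; in particular, it is either a de Sitter space or an anti-de Sitter space.
   Context: All objects are smooth. $\nabla$ is the Levi-Civita connection of $g$ and $R_{jl}$ is the Ricci tensor. The metric $g$ may be of any signature, including definite ones. An $n$-dimensional pseudo-Riemannian manifold $(M,g)$ is called generalized Ricci recurrent, denoted $(GR)_n$, if it is non-flat (its Riemann curvature tensor is not identically zero) and there exist two non-zero $1$-forms $A_i$ and $B_i$ on $M$ such that $\nabla_iR_{jl}=A_iR_{jl}+B_ig_{jl}$. Here "non-zero" means non-vanishing at every point of $M$. Conformally flat means that every point has a neighborhood on which $g$ is conformal to a flat metric. Einstein means that $R_{jl}=c\,g_{jl}$ for some constant $c$. "De Sitter space" means a pseudo-Riemannian manifold of constant positive sectional curvature, and "anti-de Sitter space" means a pseudo-Riemannian manifold of constant negative sectional curvature. No completeness or global topological type is asserted. The sectional curvature of a nondegenerate plane spanned by $x,y$ is $K=\frac{g(R(x,y)y,x)}{g(x,x)g(y,y)-g(x,y)^2}$, with the sign of $R$ chosen so that the round sphere has $K>0$. *)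

theory Defs
  imports "HOL-Analysis.Analysis"
begin

section \<open>Smooth functions on open subsets of Euclidean space\<close>

definition pderivative :: "'n::finite \<Rightarrow> (real^'n \<Rightarrow> real) \<Rightarrow> real^'n \<Rightarrow> real" where
  "pderivative i f x = frechet_derivative f (at x) (axis i 1)"

text \<open>The following two definitions are meant for open \<^term>\<open>S\<close> only.\<close>

fun Ck_on :: "nat \<Rightarrow> (real^'n::finite) set \<Rightarrow> (real^'n \<Rightarrow> real) \<Rightarrow> bool" where
  "Ck_on 0 S f \<longleftrightarrow> continuous_on S f"
| "Ck_on (Suc k) S f \<longleftrightarrow> (\<forall>x\<in>S. f differentiable (at x)) \<and> (\<forall>i. Ck_on k S (pderivative i f))"

definition smooth_on :: "(real^'n::finite) set \<Rightarrow> (real^'n \<Rightarrow> real) \<Rightarrow> bool" where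
  "smooth_on S f \<longleftrightarrow> (\<forall>k. Ck_on k S f)"


section \<open>Smooth manifolds\<close>

text \<open>A chart is a domain together with a coordinate map; the values of the map outside the domain
  are irrelevant. The dimension of the manifold is \<open>CARD('n)\<close>.\<close>

type_synonym ('a, 'n) chart = "'a set \<times> ('a \<Rightarrow> real^'n)"

abbreviation chart_dom :: "('a, 'n) chart \<Rightarrow> 'a set" where
  "chart_dom \<equiv> fst"

abbreviation coords :: "('a, 'n) chart \<Rightarrow> 'a \<Rightarrow> real^'n" where
  "coords \<equiv> snd"

definition chart_inv :: "('a, 'n) chart \<Rightarrow> real^'n \<Rightarrow> 'a" where
  "chart_inv c = inv_into (chart_dom c) (coords c)"

definition is_chart :: "'a topology \<Rightarrow> ('a, 'n::finite) chart \<Rightarrow> bool" where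
  "is_chart X c \<longleftrightarrow> openin X (chart_dom c) \<and> open (coords c ` chart_dom c) \<and>
     homeomorphic_map (subtopology X (chart_dom c)) (top_of_set (coords c ` chart_dom c)) (coords c)"

definition smooth_atlas :: "'a topology \<Rightarrow> ('a, 'n::finite) chart set \<Rightarrow> bool" where
  "smooth_atlas X \<A> \<longleftrightarrow> (\<forall>c\<in>\<A>. is_chart X c) \<and> (\<Union>c\<in>\<A>. chart_dom c) = topspace X \<and>
     (\<forall>c\<in>\<A>. \<forall>d\<in>\<A>. \<forall>i. smooth_on (coords c ` (chart_dom c \<inter> chart_dom d))
        (\<lambda>x. coords d (chart_inv c x) $ i))"

text \<open>The atlas is not required to be maximal; it represents the smooth structure it generates.\<close>

definition smooth_manifold :: "'a topology \<Rightarrow> ('a, 'n::finite) chart set \<Rightarrow> bool" where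
  "smooth_manifold X \<A> \<longleftrightarrow> Hausdorff_space X \<and> second_countable X \<and> smooth_atlas X \<A>"

definition smooth_function_on :: "('a, 'n::finite) chart set \<Rightarrow> 'a set \<Rightarrow> ('a \<Rightarrow> real) \<Rightarrow> bool" where
  "smooth_function_on \<A> U f \<longleftrightarrow>
     (\<forall>c\<in>\<A>. smooth_on (coords c ` (U \<inter> chart_dom c)) (\<lambda>x. f (chart_inv c x)))"


section \<open>Tensor fields in components\<close>

text \<open>A covariant tensor field is given classically, by its components in each chart of the atlas
  as functions of the coordinates, subject to the tensorial transformation law on overlaps:
  with \<open>J\<close> the Jacobian matrix of the change of coordinates from \<open>d\<close> to \<open>c\<close>, this is
  \<open>A'\<^sub>k = (\<Sum>i. J\<^sub>i\<^sub>k A\<^sub>i)\<close> for 1-forms and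
  \<open>T'\<^sub>k\<^sub>l = (\<Sum>i j. J\<^sub>i\<^sub>k J\<^sub>j\<^sub>l T\<^sub>i\<^sub>j)\<close> for tensors of type (0,2).\<close>

type_synonym ('a, 'n) covector_field = "('a, 'n) chart \<Rightarrow> real^'n \<Rightarrow> real^'n"
type_synonym ('a, 'n) tensor2_field = "('a, 'n) chart \<Rightarrow> real^'n \<Rightarrow> real^'n^'n"

definition transition_matrix ::
    "('a, 'n::finite) chart \<Rightarrow> ('a, 'n) chart \<Rightarrow> 'a \<Rightarrow> real^'n^'n" where
  "transition_matrix d c p = jacobian (\<lambda>y. coords c (chart_inv d y)) (at (coords d p))"

definition one_form :: "('a, 'n::finite) chart set \<Rightarrow> ('a, 'n) covector_field \<Rightarrow> bool" where
  "one_form \<A> A \<longleftrightarrow>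
     (\<forall>c\<in>\<A>. \<forall>i. smooth_on (coords c ` chart_dom c) (\<lambda>x. A c x $ i)) \<and>
     (\<forall>c\<in>\<A>. \<forall>d\<in>\<A>. \<forall>p \<in> chart_dom c \<inter> chart_dom d.
        A d (coords d p) = transpose (transition_matrix d c p) *v A c (coords c p))"

definition smooth_tensor2 :: "('a, 'n::finite) chart set \<Rightarrow> ('a, 'n) tensor2_field \<Rightarrow> bool" where
  "smooth_tensor2 \<A> T \<longleftrightarrow>
     (\<forall>c\<in>\<A>. \<forall>i j. smooth_on (coords c ` chart_dom c) (\<lambda>x. T c x $ i $ j)) \<and>
     (\<forall>c\<in>\<A>. \<forall>d\<in>\<A>. \<forall>p \<in> chart_dom c \<inter> chart_dom d.
        T d (coords d p) = transpose (transition_matrix d c p) ** T c (coords c p)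
          ** transition_matrix d c p)"

definition nowhere_vanishing :: "('a, 'n::finite) chart set \<Rightarrow> ('a, 'n) covector_field \<Rightarrow> bool" where
  "nowhere_vanishing \<A> A \<longleftrightarrow> (\<forall>c\<in>\<A>. \<forall>p \<in> chart_dom c. A c (coords c p) \<noteq> 0)"

text \<open>Index of a symmetric bilinear form: the maximal dimension of a negative definite subspace.\<close>

definition form_index :: "real^'n^'n \<Rightarrow> nat" where
  "form_index G = Max {dim V |V. subspace V \<and> (\<forall>v\<in>V. v \<noteq> 0 \<longrightarrow> v \<bullet> (G *v v) < 0)}"

definition pseudo_riemannian_metric ::
    "('a, 'n::finite) chart set \<Rightarrow> nat \<Rightarrow> ('a, 'n) tensor2_field \<Rightarrow> bool" where
  "pseudo_riemannian_metric \<A> q g \<longleftrightarrow> smooth_tensor2 \<A> g \<and>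
     (\<forall>c\<in>\<A>. \<forall>p \<in> chart_dom c.
        transpose (g c (coords c p)) = g c (coords c p) \<and>
        invertible (g c (coords c p)) \<and>
        form_index (g c (coords c p)) = q)"

definition pseudo_riemannian_manifold ::
    "'a topology \<Rightarrow> ('a, 'n::finite) chart set \<Rightarrow> nat \<Rightarrow> ('a, 'n) tensor2_field \<Rightarrow> bool" where
  "pseudo_riemannian_manifold X \<A> q g \<longleftrightarrow>
     smooth_manifold X \<A> \<and> pseudo_riemannian_metric \<A> q g"


section \<open>Levi-Civita connection and curvature in a coordinate domain\<close>

text \<open>Here \<open>G\<close> is the matrix of metric components as a function of the coordinates, and
  \<open>christoffel G x k i j\<close> is \<open>\<Gamma>\<^sup>k\<^sub>i\<^sub>j\<close>.\<close>

definition christoffel :: "(real^'n::finite \<Rightarrow> real^'n^'n) \<Rightarrow> real^'n \<Rightarrow> 'n \<Rightarrow> 'n \<Rightarrow> 'n \<Rightarrow> real" where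
  "christoffel G x k i j = (\<Sum>m\<in>UNIV. matrix_inv (G x) $ k $ m *
     (pderivative i (\<lambda>y. G y $ j $ m) x + pderivative j (\<lambda>y. G y $ i $ m) x
       - pderivative m (\<lambda>y. G y $ i $ j) x)) / 2"

text \<open>\<open>covariant_derivative \<Gamma> T x i j l\<close> is \<open>\<nabla>\<^sub>i T\<^sub>j\<^sub>l\<close> at \<open>x\<close>, where \<open>\<Gamma>\<close> are the coefficients
  of the connection at \<open>x\<close>.\<close>

definition covariant_derivative ::
    "('n::finite \<Rightarrow> 'n \<Rightarrow> 'n \<Rightarrow> real) \<Rightarrow> (real^'n \<Rightarrow> real^'n^'n) \<Rightarrow> real^'n \<Rightarrow> 'n \<Rightarrow> 'n \<Rightarrow> 'n \<Rightarrow> real" where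
  "covariant_derivative \<Gamma> T x i j l = pderivative i (\<lambda>y. T y $ j $ l) x
     - (\<Sum>m\<in>UNIV. \<Gamma> m i j * T x $ m $ l) - (\<Sum>m\<in>UNIV. \<Gamma> m i l * T x $ j $ m)"

text \<open>\<open>riemann G x l k i j\<close> is the component \<open>R\<^sup>l\<^sub>k\<^sub>i\<^sub>j\<close> defined by
  \<open>R(\<partial>\<^sub>i,\<partial>\<^sub>j)\<partial>\<^sub>k = \<nabla>\<^sub>i\<nabla>\<^sub>j\<partial>\<^sub>k - \<nabla>\<^sub>j\<nabla>\<^sub>i\<partial>\<^sub>k = (\<Sum>l. R\<^sup>l\<^sub>k\<^sub>i\<^sub>j \<partial>\<^sub>l)\<close>.
  The Ricci tensor is \<open>Ric(Y,Z) = trace (X \<mapsto> R(X,Y)Z)\<close>. With these signs the round sphere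
  has positive sectional and Ricci curvature.\<close>

definition riemann :: "(real^'n::finite \<Rightarrow> real^'n^'n) \<Rightarrow> real^'n \<Rightarrow> 'n \<Rightarrow> 'n \<Rightarrow> 'n \<Rightarrow> 'n \<Rightarrow> real" where
  "riemann G x l k i j =
     pderivative i (\<lambda>y. christoffel G y l j k) x - pderivative j (\<lambda>y. christoffel G y l i k) x
     + (\<Sum>m\<in>UNIV. christoffel G x l i m * christoffel G x m j k
               - christoffel G x l j m * christoffel G x m i k)"

definition ricci :: "(real^'n::finite \<Rightarrow> real^'n^'n) \<Rightarrow> real^'n \<Rightarrow> real^'n^'n" where
  "ricci G x = (\<chi> j k. \<Sum>i\<in>UNIV. riemann G x i k i j)"

definition riemann_op ::
    "(real^'n::finite \<Rightarrow> real^'n^'n) \<Rightarrow> real^'n \<Rightarrow> real^'n \<Rightarrow> real^'n \<Rightarrow> real^'n \<Rightarrow> real^'n" where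
  "riemann_op G x u v w =
     (\<chi> l. \<Sum>i\<in>UNIV. \<Sum>j\<in>UNIV. \<Sum>k\<in>UNIV. riemann G x l k i j * u $ i * v $ j * w $ k)"

definition metric_form :: "(real^'n::finite \<Rightarrow> real^'n^'n) \<Rightarrow> real^'n \<Rightarrow> real^'n \<Rightarrow> real^'n \<Rightarrow> real" where
  "metric_form G x u v = u \<bullet> (G x *v v)"

definition nondegenerate_plane ::
    "(real^'n::finite \<Rightarrow> real^'n^'n) \<Rightarrow> real^'n \<Rightarrow> real^'n \<Rightarrow> real^'n \<Rightarrow> bool" where
  "nondegenerate_plane G x u v \<longleftrightarrow>
     metric_form G x u u * metric_form G x v v - (metric_form G x u v)\<^sup>2 \<noteq> 0"

definition sectional_curvature ::
    "(real^'n::finite \<Rightarrow> real^'n^'n) \<Rightarrow> real^'n \<Rightarrow> real^'n \<Rightarrow> real^'n \<Rightarrow> real" where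
  "sectional_curvature G x u v = metric_form G x (riemann_op G x u v v) u /
     (metric_form G x u u * metric_form G x v v - (metric_form G x u v)\<^sup>2)"


section \<open>Classes of pseudo-Riemannian manifolds\<close>

definition flat_on :: "('a, 'n::finite) chart set \<Rightarrow> 'a set \<Rightarrow> ('a, 'n) tensor2_field \<Rightarrow> bool" where
  "flat_on \<A> U g \<longleftrightarrow>
     (\<forall>c\<in>\<A>. \<forall>p \<in> U \<inter> chart_dom c. \<forall>l k i j. riemann (g c) (coords c p) l k i j = 0)"

definition conformal_on ::
    "('a, 'n::finite) chart set \<Rightarrow> 'a set \<Rightarrow> ('a, 'n) tensor2_field \<Rightarrow> ('a, 'n) tensor2_field \<Rightarrow> bool" where
  "conformal_on \<A> U g h \<longleftrightarrow> (\<exists>\<sigma>. smooth_function_on \<A> U \<sigma> \<and>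
     (\<forall>c\<in>\<A>. \<forall>p \<in> U \<inter> chart_dom c.
        h c (coords c p) = exp (2 * \<sigma> p) *\<^sub>R g c (coords c p)))"

definition conformally_flat ::
    "'a topology \<Rightarrow> ('a, 'n::finite) chart set \<Rightarrow> ('a, 'n) tensor2_field \<Rightarrow> bool" where
  "conformally_flat X \<A> g \<longleftrightarrow> (\<forall>p \<in> topspace X. \<exists>U. openin X U \<and> p \<in> U \<and>
     (\<exists>h. conformal_on \<A> U g h \<and> flat_on \<A> U h))"

definition generalized_ricci_recurrent ::
    "'a topology \<Rightarrow> ('a, 'n::finite) chart set \<Rightarrow> ('a, 'n) tensor2_field \<Rightarrow> bool" where
  "generalized_ricci_recurrent X \<A> g \<longleftrightarrow> \<not> flat_on \<A> (topspace X) g \<and>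
     (\<exists>A B. one_form \<A> A \<and> one_form \<A> B \<and> nowhere_vanishing \<A> A \<and> nowhere_vanishing \<A> B \<and>
        (\<forall>c\<in>\<A>. \<forall>p \<in> chart_dom c. \<forall>i j l.
           covariant_derivative (christoffel (g c) (coords c p)) (ricci (g c)) (coords c p) i j l
             = A c (coords c p) $ i * ricci (g c) (coords c p) $ j $ l
               + B c (coords c p) $ i * g c (coords c p) $ j $ l))"

definition einstein :: "('a, 'n::finite) chart set \<Rightarrow> ('a, 'n) tensor2_field \<Rightarrow> bool" where
  "einstein \<A> g \<longleftrightarrow> (\<exists>a::real. \<forall>c\<in>\<A>. \<forall>p \<in> chart_dom c. \<forall>j l.
     ricci (g c) (coords c p) $ j $ l = a * g c (coords c p) $ j $ l)"

definition constant_sectional_curvature ::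
    "('a, 'n::finite) chart set \<Rightarrow> ('a, 'n) tensor2_field \<Rightarrow> real \<Rightarrow> bool" where
  "constant_sectional_curvature \<A> g K \<longleftrightarrow> (\<forall>c\<in>\<A>. \<forall>p \<in> chart_dom c. \<forall>u v.
     nondegenerate_plane (g c) (coords c p) u v \<longrightarrow>
     sectional_curvature (g c) (coords c p) u v = K)"

definition de_sitter ::
    "'a topology \<Rightarrow> ('a, 'n::finite) chart set \<Rightarrow> nat \<Rightarrow> ('a, 'n) tensor2_field \<Rightarrow> bool" where
  "de_sitter X \<A> q g \<longleftrightarrow> pseudo_riemannian_manifold X \<A> q g \<and>
     (\<exists>K>0. constant_sectional_curvature \<A> g K)"

definition anti_de_sitter ::
    "'a topology \<Rightarrow> ('a, 'n::finite) chart set \<Rightarrow> nat \<Rightarrow> ('a, 'n) tensor2_field \<Rightarrow> bool" where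
  "anti_de_sitter X \<A> q g \<longleftrightarrow> pseudo_riemannian_manifold X \<A> q g \<and>
     (\<exists>K<0. constant_sectional_curvature \<A> g K)"


section \<open>The Christoffel symbols are the coefficients of the Levi-Civita connection\<close>

text \<open>A connection is torsion-free and metric if and only if its coefficients are the Christoffel
  symbols.\<close>

lemma levi_civita_iff_christoffel:
  fixes G :: "real^'n::finite \<Rightarrow> real^'n^'n"
  assumes S: "open S" "x \<in> S"
    and sym: "\<And>y. y \<in> S \<Longrightarrow> transpose (G y) = G y"
    and diff: "\<And>i j. (\<lambda>y. G y $ i $ j) differentiable (at x)"
    and inv: "invertible (G x)"
  shows "((\<forall>k i j. \<Gamma> k i j = \<Gamma> k j i) \<and> (\<forall>k i j. covariant_derivative \<Gamma> G x k i j = 0))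
     \<longleftrightarrow> \<Gamma> = christoffel G x"
proof -
  define D where "D k i j = pderivative k (\<lambda>y. G y $ i $ j) x" for k i j
  have Gs: "G y $ i $ j = G y $ j $ i" if "y \<in> S" for y i j
    using sym[OF that] by (metis transpose_def vec_lambda_beta)
  have Ds: "D k i j = D k j i" for k i j
    unfolding D_def pderivative_def
    using frechet_derivative_transform_within_open[OF diff S, of i j "\<lambda>y. G y $ j $ i"] Gs by metis
  define H where "H = matrix_inv (G x)"
  have GH: "G x ** H = mat 1" "H ** G x = mat 1"
    using someI_ex[OF inv[unfolded invertible_def]] unfolding H_def matrix_inv_def by auto
  have GH1: "(\<Sum>m\<in>UNIV. G x $ i $ m * H $ m $ j) = (if i = j then 1 else 0)"
    and HG1: "(\<Sum>m\<in>UNIV. H $ i $ m * G x $ m $ j) = (if i = j then 1 else 0)" for i j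
    using GH[THEN arg_cong, of "\<lambda>M. M $ i $ j"]
    by (simp_all add: matrix_matrix_mult_def mat_def)
  have lower: "(\<Sum>k\<in>UNIV. G x $ a $ k * (\<Sum>m\<in>UNIV. H $ k $ m * f m)) = f a" for a f
  proof -
    have "(\<Sum>k\<in>UNIV. G x $ a $ k * (\<Sum>m\<in>UNIV. H $ k $ m * f m))
        = (\<Sum>m\<in>UNIV. (\<Sum>k\<in>UNIV. G x $ a $ k * H $ k $ m) * f m)"
      by (simp add: sum_distrib_left sum_distrib_right mult.assoc, rule sum.swap)
    also have "\<dots> = f a" by (simp add: GH1 if_distrib[of "\<lambda>t. t * _"] cong: if_cong)
    finally show ?thesis .
  qed
  have raise: "(\<Sum>k\<in>UNIV. H $ a $ k * (\<Sum>m\<in>UNIV. G x $ k $ m * f m)) = f a" for a f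
  proof -
    have "(\<Sum>k\<in>UNIV. H $ a $ k * (\<Sum>m\<in>UNIV. G x $ k $ m * f m))
        = (\<Sum>m\<in>UNIV. (\<Sum>k\<in>UNIV. H $ a $ k * G x $ k $ m) * f m)"
      by (simp add: sum_distrib_left sum_distrib_right mult.assoc, rule sum.swap)
    also have "\<dots> = f a" by (simp add: HG1 if_distrib[of "\<lambda>t. t * _"] cong: if_cong)
    finally show ?thesis .
  qed
  define L where "L \<Gamma> a i j = (\<Sum>m\<in>UNIV. G x $ a $ m * \<Gamma> m i j)"
    for \<Gamma> :: "'n \<Rightarrow> 'n \<Rightarrow> 'n \<Rightarrow> real" and a i j
  have cov: "covariant_derivative \<Gamma> G x k i j = D k i j - L \<Gamma> j k i - L \<Gamma> i k j" for \<Gamma> k i j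
    unfolding covariant_derivative_def D_def L_def using Gs[OF S(2)] by (simp add: mult.commute)
  have chr: "christoffel G x k i j = (\<Sum>m\<in>UNIV. H $ k $ m * ((D i j m + D j i m - D m i j) / 2))"
    for k i j
    unfolding christoffel_def D_def H_def by (simp add: sum_divide_distrib)
  have Lchr: "L (christoffel G x) a i j = (D i j a + D j i a - D a i j) / 2" for a i j
    unfolding L_def chr by (rule lower)
  show ?thesis
  proof
    assume *: "(\<forall>k i j. \<Gamma> k i j = \<Gamma> k j i) \<and> (\<forall>k i j. covariant_derivative \<Gamma> G x k i j = 0)"
    have Ls: "L \<Gamma> a i j = L \<Gamma> a j i" for a i j using * by (simp add: L_def)
    have Dk: "D k i j = L \<Gamma> j k i + L \<Gamma> i k j" for k i j using * cov[of \<Gamma> k i j] by simp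
    have "L \<Gamma> a i j = (D i j a + D j i a - D a i j) / 2" for a i j
      using Dk[of i j a] Dk[of j i a] Dk[of a i j] Ls[of a i j] Ls[of j i a] Ls[of i j a]
      by simp
    then have "L \<Gamma> = L (christoffel G x)" by (simp add: fun_eq_iff Lchr)
    moreover have "\<Gamma>' k i j = (\<Sum>a\<in>UNIV. H $ k $ a * L \<Gamma>' a i j)" for \<Gamma>' k i j
      unfolding L_def by (rule raise[symmetric])
    ultimately show "\<Gamma> = christoffel G x" by (metis ext)
  next
    assume *: "\<Gamma> = christoffel G x"
    show "(\<forall>k i j. \<Gamma> k i j = \<Gamma> k j i) \<and> (\<forall>k i j. covariant_derivative \<Gamma> G x k i j = 0)"
    proof (intro conjI allI)
      fix k i j
      show "\<Gamma> k i j = \<Gamma> k j i" unfolding * chr by (simp add: Ds[of _ i j] add.commute)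
      show "covariant_derivative \<Gamma> G x k i j = 0"
        unfolding cov unfolding * Lchr using Ds[of i j k] Ds[of j i k] Ds[of k i j] by (simp add: field_simps)
    qed
  qed
qed

end

theory Submission
  imports Defs
begin

text \<open>Write \<open>R\<close> as the Kulkarni-Nomizu product of \<open>g\<close> with the Schouten tensor \<open>T\<close>; conformal flatness gives this formula and the Codazzi equation
  \<open>\<nabla>\<^sub>i T\<^sub>j\<^sub>k = \<nabla>\<^sub>j T\<^sub>i\<^sub>k\<close>. The recurrence equation becomes \<open>\<nabla>\<^sub>i T\<^sub>j\<^sub>k = A\<^sub>i T\<^sub>j\<^sub>k + C\<^sub>i g\<^sub>j\<^sub>k\<close>, and antisymmetrising it
  forces \<open>C = -\<tau> A\<close>, \<open>T = \<tau> g + \<mu> A \<otimes> A\<close> and, after taking traces, \<open>B = -2(n-1)\<tau> A\<close> and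
  \<open>d(tr T) = (tr T - n\<tau>) A\<close>; in particular \<open>\<tau>\<close> vanishes nowhere.

  Suppose \<open>\<mu> \<noteq> 0\<close> at some point. Differentiating the vanishing \<open>2 \<times> 2\<close> minors of \<open>T - \<tau> g\<close> shows that \<open>\<tau>\<close> is locally
  constant there, so \<open>\<nabla>(\<mu> A \<otimes> A) = A \<otimes> \<mu> A \<otimes> A\<close> and \<open>A\<close> is recurrent. The Ricci identity for \<open>A\<close> then gives
  \<open>tr T = (n-2)\<tau>\<close>, hence \<open>0 = d(tr T) = -2\<tau> A\<close>, which is absurd. So \<open>T = \<tau> g\<close>, and \<open>\<nabla>T = 0\<close> makes \<open>\<tau>\<close>
  locally constant. Since \<open>B = -2(n-1)\<tau> A\<close> determines \<open>\<tau>\<close> independently of the chart, it is constant on \<open>M\<close>, and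
  the sectional curvature is \<open>2\<tau> \<noteq> 0\<close>.\<close>

section \<open>Calculus of partial derivatives\<close>

lemma pderivative_eqI:
  assumes "(f has_derivative f') (at x)"
  shows "pderivative i f x = f' (axis i 1)"
  unfolding pderivative_def using frechet_derivative_at[OF assms] by simp

lemma has_derivative_frechet:
  "f differentiable (at x) \<Longrightarrow> (f has_derivative frechet_derivative f (at x)) (at x)"
  by (simp add: frechet_derivative_works)

text \<open>Both functions have the same derivatives at \<open>x\<close>, and
  \<open>frechet_derivative\<close> is a choice depending only on that set, so the choices agree
  even where no derivative exists.\<close>

lemma pderivative_cong:
  assumes "open S" "x \<in> S" "\<And>y. y \<in> S \<Longrightarrow> f y = g y"
  shows "pderivative i f x = pderivative i g x"
proof -
  have "(f has_derivative f') (at x) \<longleftrightarrow> (g has_derivative f') (at x)" for f'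
    using assms has_derivative_transform_within_open[of f f' x UNIV S g]
      has_derivative_transform_within_open[of g f' x UNIV S f] by auto
  then show ?thesis by (simp add: pderivative_def frechet_derivative_def)
qed

lemma differentiable_cong_open:
  assumes "open S" "x \<in> S" "\<And>y. y \<in> S \<Longrightarrow> f y = g y"
  shows "f differentiable (at x) \<longleftrightarrow> g differentiable (at x)"
  unfolding differentiable_def
  using assms has_derivative_transform_within_open[of f _ x UNIV S g]
      has_derivative_transform_within_open[of g _ x UNIV S f] by metis

lemma pderivative_const [simp]: "pderivative i (\<lambda>x. c) x = 0"
  by (simp add: pderivative_def)

lemma pderivative_add:
  assumes "f differentiable (at x)" "g differentiable (at x)"
  shows "pderivative i (\<lambda>x. f x + g x) x = pderivative i f x + pderivative i g x"
  using pderivative_eqI[OF has_derivative_add[OF assms[THEN has_derivative_frechet]]]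
  by (simp add: pderivative_def)

lemma pderivative_diff:
  assumes "f differentiable (at x)" "g differentiable (at x)"
  shows "pderivative i (\<lambda>x. f x - g x) x = pderivative i f x - pderivative i g x"
  using pderivative_eqI[OF has_derivative_diff[OF assms[THEN has_derivative_frechet]]]
  by (simp add: pderivative_def)

lemma pderivative_mult:
  assumes "f differentiable (at x)" "g differentiable (at x)"
  shows "pderivative i (\<lambda>x. f x * g x) x = f x * pderivative i g x + pderivative i f x * g x"
  using pderivative_eqI[OF has_derivative_mult[OF assms[THEN has_derivative_frechet]]]
  by (simp add: pderivative_def)

lemma pderivative_sum:
  assumes "\<And>a. a \<in> I \<Longrightarrow> f a differentiable (at x)"
  shows "pderivative i (\<lambda>x. \<Sum>a\<in>I. f a x) x = (\<Sum>a\<in>I. pderivative i (f a) x)"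
  using pderivative_eqI[OF has_derivative_sum[OF has_derivative_frechet[OF assms]]]
  by (simp add: pderivative_def)

lemma pderivative_inverse:
  assumes "f differentiable (at x)" "f x \<noteq> 0"
  shows "pderivative i (\<lambda>x. inverse (f x)) x = - (inverse (f x) * pderivative i f x * inverse (f x))"
  using pderivative_eqI[OF Deriv.has_derivative_inverse[OF assms(2) has_derivative_frechet[OF assms(1)]]]
  by (simp add: pderivative_def)

lemma pderivative_exp:
  assumes "f differentiable (at x)"
  shows "pderivative i (\<lambda>x. exp (f x)) x = exp (f x) * pderivative i f x"
  using pderivative_eqI[OF has_derivative_exp[OF has_derivative_frechet[OF assms]]]
  by (simp add: pderivative_def)

lemma frechet_derivative_pderivatives:
  fixes f :: "real^'n::finite \<Rightarrow> real"
  assumes "f differentiable (at x)"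
  shows "frechet_derivative f (at x) h = (\<Sum>i\<in>UNIV. h $ i * pderivative i f x)"
proof -
  have lin: "linear (frechet_derivative f (at x))" by (rule linear_frechet_derivative[OF assms])
  have "frechet_derivative f (at x) h = frechet_derivative f (at x) (\<Sum>i\<in>UNIV. (h $ i) *\<^sub>R axis i 1)"
    using basis_expansion[of h] by (simp add: scalar_mult_eq_scaleR)
  also have "\<dots> = (\<Sum>i\<in>UNIV. h $ i * pderivative i f x)"
    by (simp add: linear_sum[OF lin] linear_scale[OF lin] pderivative_def)
  finally show ?thesis .
qed

text \<open>The second difference of \<open>f\<close> over a small square with sides along
  \<open>i\<close> and \<open>j\<close> is symmetric in the two directions. Two applications of the
  mean value theorem turn it into the area times a mixed derivative at a nearby point, in either
  order; continuity of the mixed derivatives concludes.\<close>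

lemma pderivative_commute:
  fixes f :: "real^'n::finite \<Rightarrow> real"
  assumes S: "open S" "x \<in> S" and f: "Ck_on 2 S f"
  shows "pderivative i (pderivative j f) x = pderivative j (pderivative i f) x"
proof (rule ccontr)
  have df: "f differentiable (at y)" "pderivative k f differentiable (at y)"
    and cf: "continuous_on S (pderivative l (pderivative k f))" if "y \<in> S" for y k l
    using f that by (auto simp: numeral_2_eq_2)
  assume ne: "\<not> ?thesis"
  \<comment> \<open>Half the gap: values within \<open>e\<close> of the two mixed derivatives at
    \<open>x\<close> cannot coincide.\<close>
  define e where "e = \<bar>pderivative i (pderivative j f) x - pderivative j (pderivative i f) x\<bar> / 2"
  have e: "e > 0" using ne by (simp add: e_def)
  have near: "\<exists>d>0. \<forall>y. dist y x < d \<longrightarrow> y \<in> S \<and> \<bar>pderivative l (pderivative k f) y - pderivative l (pderivative k f) x\<bar> < e" for k l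
  proof -
    obtain d1 where d1: "d1 > 0" "\<And>y. y \<in> S \<Longrightarrow> dist y x < d1 \<Longrightarrow>
        dist (pderivative l (pderivative k f) y) (pderivative l (pderivative k f) x) < e"
      using cf[OF S(2), of l k, unfolded continuous_on_iff] S(2) e by metis
    obtain d2 where d2: "d2 > 0" "ball x d2 \<subseteq> S" using S open_contains_ball by metis
    show ?thesis
      using d1 d2 by (intro exI[of _ "min d1 d2"]) (auto simp: dist_real_def dist_commute subset_iff)
  qed
  obtain d where d: "d > 0" "\<And>y. dist y x < d \<Longrightarrow> y \<in> S"
      "\<And>y. dist y x < d \<Longrightarrow> \<bar>pderivative i (pderivative j f) y - pderivative i (pderivative j f) x\<bar> < e"
      "\<And>y. dist y x < d \<Longrightarrow> \<bar>pderivative j (pderivative i f) y - pderivative j (pderivative i f) x\<bar> < e"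
  proof -
    obtain d1 where "d1 > 0" and d1: "\<And>y. dist y x < d1 \<Longrightarrow> y \<in> S \<and> \<bar>pderivative i (pderivative j f) y - pderivative i (pderivative j f) x\<bar> < e"
      using near[of i j] by blast
    obtain d2 where "d2 > 0" and d2: "\<And>y. dist y x < d2 \<Longrightarrow> y \<in> S \<and> \<bar>pderivative j (pderivative i f) y - pderivative j (pderivative i f) x\<bar> < e"
      using near[of j i] by blast
    show ?thesis using that[of "min d1 d2"] d1 d2 \<open>d1 > 0\<close> \<open>d2 > 0\<close> by simp
  qed
  \<comment> \<open>With this side length every point of the square lies within \<open>d / 2\<close>
    of \<open>x\<close>.\<close>
  define t where "t = d / 4"
  have t: "t > 0" using d by (simp add: t_def)
  define P where "P k l r q = x + r *\<^sub>R axis k 1 + q *\<^sub>R axis l (1::real)" for k l and r q :: real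
  have PS: "dist (P k l r q) x < d" if "0 \<le> r" "r \<le> t" "0 \<le> q" "q \<le> t" for k l r q
  proof -
    have "dist (P k l r q) x = norm (r *\<^sub>R axis k 1 + q *\<^sub>R axis l (1::real) :: real^'n)"
      by (simp add: P_def dist_norm algebra_simps)
    also have "\<dots> \<le> r + q"
      using norm_triangle_ineq[of "r *\<^sub>R axis k 1 :: real^'n" "q *\<^sub>R axis l 1"] that by simp
    also have "\<dots> < d" using that d by (simp add: t_def)
    finally show ?thesis .
  qed
  have lineder: "((\<lambda>r. F (P k l r q)) has_real_derivative pderivative k F (P k l r q)) (at r)"
    if "F differentiable (at (P k l r q))" for F k l r q
  proof -
    have "((\<lambda>r. P k l r q) has_derivative (\<lambda>h. h *\<^sub>R axis k 1)) (at r)"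
      unfolding P_def by (auto intro!: derivative_eq_intros)
    from has_derivative_compose[OF this has_derivative_frechet[OF that]]
    have "((\<lambda>r. F (P k l r q)) has_derivative (\<lambda>h. frechet_derivative F (at (P k l r q)) (h *\<^sub>R axis k 1))) (at r)" .
    moreover have "frechet_derivative F (at (P k l r q)) (h *\<^sub>R axis k 1) = pderivative k F (P k l r q) * h" for h
      using linear_scale[OF linear_frechet_derivative[OF that]] by (simp add: pderivative_def)
    ultimately show ?thesis by (simp add: has_field_derivative_def)
  qed
  have Pc: "P k l r q = P l k q r" for k l r q by (simp add: P_def algebra_simps)
  have key: "\<exists>y. dist y x < d \<and> f (P k l t t) - f (P k l t 0) - f (P k l 0 t) + f (P k l 0 0)
      = t * t * pderivative l (pderivative k f) y" for k l
  proof -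
    define \<phi> where "\<phi> r = f (P k l r t) - f (P k l r 0)" for r
    have "\<exists>z. 0 < z \<and> z < t \<and> \<phi> t - \<phi> 0 = (t - 0) * (pderivative k f (P k l z t) - pderivative k f (P k l z 0))"
      unfolding \<phi>_def using t
      by (intro MVT2) (auto intro!: derivative_intros lineder df(1) d(2) PS)
    then obtain z where z: "0 < z" "z < t" "\<phi> t - \<phi> 0 = t * (pderivative k f (P k l z t) - pderivative k f (P k l z 0))"
      by auto
    have "\<exists>w. 0 < w \<and> w < t \<and> pderivative k f (P l k t z) - pderivative k f (P l k 0 z)
        = (t - 0) * pderivative l (pderivative k f) (P l k w z)"
      using t z by (intro MVT2) (auto intro!: lineder df(2) d(2) PS)
    then obtain w where w: "0 < w" "w < t" "pderivative k f (P l k t z) - pderivative k f (P l k 0 z)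
        = t * pderivative l (pderivative k f) (P l k w z)"
      by auto
    have "dist (P l k w z) x < d" using z w by (intro PS) auto
    moreover have "f (P k l t t) - f (P k l t 0) - f (P k l 0 t) + f (P k l 0 0) = t * t * pderivative l (pderivative k f) (P l k w z)"
      using z(3) w(3) by (simp add: \<phi>_def Pc[of k l])
    ultimately show ?thesis by blast
  qed
  obtain y where y: "dist y x < d" "f (P j i t t) - f (P j i t 0) - f (P j i 0 t) + f (P j i 0 0)
      = t * t * pderivative i (pderivative j f) y" using key by blast
  obtain z where z: "dist z x < d" "f (P i j t t) - f (P i j t 0) - f (P i j 0 t) + f (P i j 0 0)
      = t * t * pderivative j (pderivative i f) z" using key by blast
  have "t * t * pderivative i (pderivative j f) y = t * t * pderivative j (pderivative i f) z"
    using y(2) z(2) unfolding Pc[of j i] by linarith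
  then have "pderivative i (pderivative j f) y = pderivative j (pderivative i f) z" using t by simp
  then show False using d(3)[OF y(1)] d(4)[OF z(1)] unfolding e_def by (smt (verit) field_sum_of_halves)
qed

section \<open>Smooth functions\<close>

lemma Ck_on_cong:
  assumes "open S" "\<And>x. x \<in> S \<Longrightarrow> f x = g x"
  shows "Ck_on k S f \<longleftrightarrow> Ck_on k S g"
  using assms(2)
proof (induction k arbitrary: f g)
  case 0
  then show ?case by (simp cong: continuous_on_cong)
next
  case (Suc k)
  have "Ck_on k S (pderivative i f) \<longleftrightarrow> Ck_on k S (pderivative i g)" for i
    using Suc.prems by (intro Suc.IH pderivative_cong[OF assms(1)])
  then show ?case using differentiable_cong_open[OF assms(1) _ Suc.prems] by simp
qed

lemma smooth_on_cong:
  assumes "open S" "\<And>x. x \<in> S \<Longrightarrow> f x = g x"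
  shows "smooth_on S f \<longleftrightarrow> smooth_on S g"
  unfolding smooth_on_def using Ck_on_cong[OF assms] by simp

lemma Ck_on_subset: "Ck_on k S f \<Longrightarrow> R \<subseteq> S \<Longrightarrow> Ck_on k R f"
  by (induction k arbitrary: f) (auto intro: continuous_on_subset)

lemma smooth_on_subset: "smooth_on S f \<Longrightarrow> R \<subseteq> S \<Longrightarrow> smooth_on R f"
  unfolding smooth_on_def using Ck_on_subset by blast

lemma Ck_on_SucD: "Ck_on (Suc k) S f \<Longrightarrow> Ck_on k S f"
proof (induction k arbitrary: f)
  case 0
  then show ?case
    by (auto intro: continuous_at_imp_continuous_on differentiable_imp_continuous_within)
next
  case (Suc k)
  have "Ck_on k S (pderivative i f)" for i
    using Suc.prems Ck_on.simps(2)[of "Suc k" S f] by (intro Suc.IH) blast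
  then show ?case using Suc.prems Ck_on.simps(2) by blast
qed

lemma smooth_on_differentiable: "smooth_on S f \<Longrightarrow> x \<in> S \<Longrightarrow> f differentiable (at x)"
  unfolding smooth_on_def by (metis Ck_on.simps(2))

lemma smooth_on_pderivative [intro]: "smooth_on S f \<Longrightarrow> smooth_on S (pderivative i f)"
  unfolding smooth_on_def by (metis Ck_on.simps(2))

lemma smooth_on_continuous: "smooth_on S f \<Longrightarrow> continuous_on S f"
  unfolding smooth_on_def by (metis Ck_on.simps(1))

lemma smooth_on_const [intro]: "smooth_on S (\<lambda>x. c)"
proof -
  have "Ck_on k S (\<lambda>x. c)" for k and c
  proof (induction k arbitrary: c)
    case (Suc k)
    have "pderivative i (\<lambda>x::real^'a. c) = (\<lambda>x. 0)" for i by (simp add: fun_eq_iff)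
    then show ?case using Suc by simp
  qed auto
  then show ?thesis by (simp add: smooth_on_def)
qed

section \<open>Closure of smooth functions under algebraic operations\<close>

lemma Ck_on_add: "open S \<Longrightarrow> Ck_on k S f \<Longrightarrow> Ck_on k S g \<Longrightarrow> Ck_on k S (\<lambda>x. f x + g x)"
proof (induction k arbitrary: f g)
  case (Suc k)
  have "Ck_on k S (pderivative i (\<lambda>x. f x + g x))" for i
    using Suc by (subst Ck_on_cong[of S _ "\<lambda>x. pderivative i f x + pderivative i g x"])
      (auto intro: pderivative_add)
  then show ?case using Suc by auto
qed (auto intro: continuous_intros)

lemma Ck_on_mult: "open S \<Longrightarrow> Ck_on k S f \<Longrightarrow> Ck_on k S g \<Longrightarrow> Ck_on k S (\<lambda>x. f x * g x)"
proof (induction k arbitrary: f g)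
  case (Suc k)
  have "Ck_on k S (pderivative i (\<lambda>x. f x * g x))" for i
  proof (subst Ck_on_cong[of S _ "\<lambda>x. f x * pderivative i g x + pderivative i f x * g x"])
    show "Ck_on k S (\<lambda>x. f x * pderivative i g x + pderivative i f x * g x)"
      using Suc.prems Suc.prems(2,3)[THEN Ck_on_SucD] by (intro Ck_on_add Suc.IH) auto
  qed (use Suc.prems in \<open>auto intro: pderivative_mult\<close>)
  then show ?case using Suc by auto
qed (auto intro: continuous_intros)

lemma Ck_on_inverse: "open S \<Longrightarrow> (\<And>x. x \<in> S \<Longrightarrow> f x \<noteq> 0) \<Longrightarrow> Ck_on k S f \<Longrightarrow> Ck_on k S (\<lambda>x. inverse (f x))"
proof (induction k)
  case (Suc k)
  have "Ck_on k S (pderivative i (\<lambda>x. inverse (f x)))" for i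
  proof (subst Ck_on_cong[of S _ "\<lambda>x. (- 1) * (inverse (f x) * pderivative i f x * inverse (f x))"])
    show "Ck_on k S (\<lambda>x. (- 1) * (inverse (f x) * pderivative i f x * inverse (f x)))"
      using Suc.prems Suc.IH[OF Suc.prems(1,2) Ck_on_SucD[OF Suc.prems(3)]] smooth_on_const[of S "-1"]
      by (intro Ck_on_mult) (auto simp: smooth_on_def)
  qed (use Suc.prems in \<open>simp_all add: pderivative_inverse\<close>)
  then show ?case using Suc by (auto intro: differentiable_inverse)
qed (auto intro: continuous_intros)

lemma smooth_on_add [intro]: "open S \<Longrightarrow> smooth_on S f \<Longrightarrow> smooth_on S g \<Longrightarrow> smooth_on S (\<lambda>x. f x + g x)"
  unfolding smooth_on_def using Ck_on_add by blast

lemma smooth_on_mult [intro]: "open S \<Longrightarrow> smooth_on S f \<Longrightarrow> smooth_on S g \<Longrightarrow> smooth_on S (\<lambda>x. f x * g x)"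
  unfolding smooth_on_def using Ck_on_mult by blast

lemma smooth_on_inverse [intro]:
  "open S \<Longrightarrow> (\<And>x. x \<in> S \<Longrightarrow> f x \<noteq> 0) \<Longrightarrow> smooth_on S f \<Longrightarrow> smooth_on S (\<lambda>x. inverse (f x))"
  unfolding smooth_on_def using Ck_on_inverse by blast

lemma smooth_on_divide [intro]:
  "open S \<Longrightarrow> (\<And>x. x \<in> S \<Longrightarrow> g x \<noteq> 0) \<Longrightarrow> smooth_on S f \<Longrightarrow> smooth_on S g \<Longrightarrow> smooth_on S (\<lambda>x. f x / g x)"
  unfolding divide_inverse by (intro smooth_on_mult smooth_on_inverse)

lemma smooth_on_uminus [intro]: "open S \<Longrightarrow> smooth_on S f \<Longrightarrow> smooth_on S (\<lambda>x. - f x)"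
  using smooth_on_mult[OF _ smooth_on_const[of S "-1"]] by simp

lemma smooth_on_diff [intro]: "open S \<Longrightarrow> smooth_on S f \<Longrightarrow> smooth_on S g \<Longrightarrow> smooth_on S (\<lambda>x. f x - g x)"
  using smooth_on_add[OF _ _ smooth_on_uminus] by force

lemma smooth_on_sum [intro]:
  "open S \<Longrightarrow> (\<And>a. a \<in> I \<Longrightarrow> smooth_on S (f a)) \<Longrightarrow> smooth_on S (\<lambda>x. \<Sum>a\<in>I. f a x)"
  by (induction I rule: infinite_finite_induct) auto

lemma smooth_on_prod [intro]:
  "open S \<Longrightarrow> (\<And>a. a \<in> I \<Longrightarrow> smooth_on S (f a)) \<Longrightarrow> smooth_on S (\<lambda>x. \<Prod>a\<in>I. f a x)"
  by (induction I rule: infinite_finite_induct) auto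

lemma smooth_on_det:
  fixes M :: "real^'n::finite \<Rightarrow> real^'m::finite^'m"
  assumes "open S" "\<And>i j. smooth_on S (\<lambda>x. M x $ i $ j)"
  shows "smooth_on S (\<lambda>x. det (M x))"
  unfolding det_def using assms by (intro smooth_on_sum smooth_on_mult smooth_on_prod smooth_on_const)

lemma matrix_inv_works:
  fixes M :: "real^'m::finite^'m"
  assumes "invertible M"
  shows "M ** matrix_inv M = mat 1" "matrix_inv M ** M = mat 1"
  using someI_ex[OF assms[unfolded invertible_def]] unfolding matrix_inv_def by auto

text \<open>Cramer's rule writes each entry of the inverse as a quotient of determinants, which are
  polynomials in the entries of \<open>M\<close>.\<close>

lemma smooth_on_matrix_inv:
  fixes M :: "real^'n::finite \<Rightarrow> real^'m::finite^'m"
  assumes S: "open S" and M: "\<And>i j. smooth_on S (\<lambda>x. M x $ i $ j)"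
    and inv: "\<And>x. x \<in> S \<Longrightarrow> invertible (M x)"
  shows "smooth_on S (\<lambda>x. matrix_inv (M x) $ k $ l)"
proof -
  \<comment> \<open>\<open>M x\<close> with column \<open>k\<close> replaced by the basis vector
    \<open>axis l 1\<close>.\<close>
  define C where "C x = (\<chi> i j. if j = k then axis l 1 $ i else M x $ i $ j)" for x
  have "matrix_inv (M x) $ k $ l = det (C x) / det (M x)" if "x \<in> S" for x
  proof -
    have "M x *v (matrix_inv (M x) *v axis l 1) = axis l 1"
      using matrix_inv_works[OF inv[OF that]] by (simp add: matrix_vector_mul_assoc)
    then have "matrix_inv (M x) *v axis l 1 = (\<chi> k. det (\<chi> i j. if j = k then axis l 1 $ i else M x $ i $ j) / det (M x))"
      using cramer[of "M x"] inv[OF that] by (simp add: invertible_det_nz)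
    then have "(matrix_inv (M x) *v axis l 1) $ k = det (C x) / det (M x)"
      by (simp add: C_def)
    then show ?thesis by (simp add: matrix_vector_mult_basis column_def)
  qed
  moreover have "smooth_on S (\<lambda>x. det (C x) / det (M x))"
  proof (intro smooth_on_divide smooth_on_det S M)
    show "smooth_on S (\<lambda>x. C x $ i $ j)" for i j
      using M by (cases "j = k") (auto simp: C_def)
    show "det (M x) \<noteq> 0" if "x \<in> S" for x
      using inv[OF that] by (simp add: invertible_det_nz)
  qed
  ultimately show ?thesis using smooth_on_cong[OF S] by (metis (no_types, lifting))
qed

section \<open>Coordinate domains of pseudo-Riemannian metrics\<close>

definition kronecker :: "'n \<Rightarrow> 'n \<Rightarrow> real" where
  "kronecker i j = (if i = j then 1 else 0)"

lemma kronecker_refl [simp]: "kronecker i i = 1"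
  by (simp add: kronecker_def)

lemma kronecker_commute: "kronecker i j = kronecker j i"
  by (simp add: kronecker_def)

lemma sum_kronecker [simp]:
  fixes f :: "'n::finite \<Rightarrow> real"
  shows "(\<Sum>m\<in>UNIV. kronecker i m * f m) = f i" "(\<Sum>m\<in>UNIV. kronecker m i * f m) = f i"
    "(\<Sum>m\<in>UNIV. f m * kronecker i m) = f i" "(\<Sum>m\<in>UNIV. f m * kronecker m i) = f i"
  by (simp_all add: kronecker_def if_distrib[of "\<lambda>t. t * _"] if_distrib[of "\<lambda>t. _ * t"] cong: if_cong)

lemma sum_sum_mult_swap:
  fixes a c :: "'n::finite \<Rightarrow> real"
  shows "(\<Sum>m\<in>UNIV. a m * (\<Sum>p\<in>UNIV. b p m * c p)) = (\<Sum>p\<in>UNIV. (\<Sum>m\<in>UNIV. b p m * a m) * c p)"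
  by (simp add: sum_distrib_left sum_distrib_right mult_ac, rule sum.swap)

lemma sum_sum_mult_swap':
  fixes a c :: "'n::finite \<Rightarrow> real"
  shows "(\<Sum>m\<in>UNIV. a m * (\<Sum>p\<in>UNIV. b p m * c p)) = (\<Sum>p\<in>UNIV. (\<Sum>m\<in>UNIV. a m * b p m) * c p)"
  by (simp add: sum_distrib_left sum_distrib_right mult.assoc, rule sum.swap)

text \<open>Only smoothness, symmetry and nondegeneracy of the metric are kept, so everything
  derived here holds in any signature.\<close>

locale metric_chart =
  fixes S :: "(real^'n::finite) set" and G :: "real^'n \<Rightarrow> real^'n^'n"
  assumes open_S: "open S"
    and smooth_G: "\<And>i j. smooth_on S (\<lambda>x. G x $ i $ j)"
    and sym_G: "\<And>x. x \<in> S \<Longrightarrow> transpose (G x) = G x"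
    and inv_G: "\<And>x. x \<in> S \<Longrightarrow> invertible (G x)"
begin

abbreviation \<Gamma> where "\<Gamma> \<equiv> christoffel G"
abbreviation H where "H x \<equiv> matrix_inv (G x)"

lemma G_commute: "x \<in> S \<Longrightarrow> G x $ i $ j = G x $ j $ i"
  using sym_G[THEN arg_cong, of x "\<lambda>M. M $ j $ i"] by (simp add: transpose_def)

lemma smooth_differentiable [intro]: "smooth_on S f \<Longrightarrow> x \<in> S \<Longrightarrow> f differentiable (at x)"
  by (rule smooth_on_differentiable)

lemma GH: "x \<in> S \<Longrightarrow> (\<Sum>m\<in>UNIV. G x $ i $ m * H x $ m $ j) = kronecker i j"
  and HG: "x \<in> S \<Longrightarrow> (\<Sum>m\<in>UNIV. H x $ i $ m * G x $ m $ j) = kronecker i j"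
  using matrix_inv_works[OF inv_G, THEN arg_cong, of x "\<lambda>M. M $ i $ j"]
  by (simp_all add: matrix_matrix_mult_def mat_def kronecker_def)

lemma lower_raise:
  assumes "x \<in> S"
  shows "(\<Sum>k\<in>UNIV. G x $ a $ k * (\<Sum>m\<in>UNIV. H x $ k $ m * f m)) = f a"
  using sum_sum_mult_swap[of "\<lambda>k. G x $ a $ k" "\<lambda>m k. H x $ k $ m" f] GH[OF assms]
  by (simp add: mult.commute)

lemma raise_lower:
  assumes "x \<in> S"
  shows "(\<Sum>k\<in>UNIV. H x $ a $ k * (\<Sum>m\<in>UNIV. G x $ k $ m * f m)) = f a"
  using sum_sum_mult_swap[of "\<lambda>k. H x $ a $ k" "\<lambda>m k. G x $ k $ m" f] HG[OF assms]
  by (simp add: mult.commute)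

lemma H_commute:
  assumes x: "x \<in> S"
  shows "H x $ i $ j = H x $ j $ i"
proof -
  have "(\<Sum>m\<in>UNIV. G x $ k $ m * H x $ j $ m) = kronecker k j" for k
    using HG[OF x, of j k] by (simp add: G_commute[OF x, of k] mult.commute kronecker_commute)
  then have "(\<Sum>k\<in>UNIV. H x $ i $ k * kronecker k j) = H x $ j $ i"
    using raise_lower[OF x, of i "\<lambda>m. H x $ j $ m"] by simp
  then show ?thesis by simp
qed

lemma smooth_H: "smooth_on S (\<lambda>x. H x $ i $ j)"
  by (intro smooth_on_matrix_inv open_S smooth_G inv_G)

lemma smooth_\<Gamma>: "smooth_on S (\<lambda>x. \<Gamma> x k i j)"
  unfolding christoffel_def
  by (intro smooth_on_divide smooth_on_sum smooth_on_mult smooth_on_diff smooth_on_add smooth_on_pderivative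
      smooth_H smooth_G smooth_on_const open_S) simp

lemma levi_civita:
  assumes x: "x \<in> S"
  shows "\<Gamma> x k i j = \<Gamma> x k j i" "covariant_derivative (\<Gamma> x) G x i j k = 0"
  using levi_civita_iff_christoffel[OF open_S x sym_G smooth_differentiable[OF smooth_G x] inv_G[OF x], of "\<Gamma> x"]
  by auto

lemma pderivative_G:
  "x \<in> S \<Longrightarrow> pderivative i (\<lambda>y. G y $ j $ k) x
     = (\<Sum>m\<in>UNIV. \<Gamma> x m i j * G x $ m $ k) + (\<Sum>m\<in>UNIV. \<Gamma> x m i k * G x $ j $ m)"
  using levi_civita(2)[of x i j k] by (simp add: covariant_derivative_def)

section \<open>Covariant derivatives and the Ricci identity\<close>

definition nabla :: "('n \<Rightarrow> real^'n \<Rightarrow> real) \<Rightarrow> 'n \<Rightarrow> 'n \<Rightarrow> real^'n \<Rightarrow> real" where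
  "nabla s i j x = pderivative i (s j) x - (\<Sum>m\<in>UNIV. \<Gamma> x m i j * s m x)"

lemma smooth_nabla: "(\<And>j. smooth_on S (s j)) \<Longrightarrow> smooth_on S (nabla s i j)"
  unfolding nabla_def
  by (intro smooth_on_diff smooth_on_sum smooth_on_mult smooth_on_pderivative smooth_\<Gamma> open_S)

text \<open>The operation of \<open>covariant_derivative\<close> for a tensor given as a family of
  component functions, so that it can be applied to \<open>nabla s\<close> to form second
  derivatives.\<close>

definition nabla2 :: "('n \<Rightarrow> 'n \<Rightarrow> real^'n \<Rightarrow> real) \<Rightarrow> 'n \<Rightarrow> 'n \<Rightarrow> 'n \<Rightarrow> real^'n \<Rightarrow> real" where
  "nabla2 T i j l x = pderivative i (T j l) x
     - (\<Sum>m\<in>UNIV. \<Gamma> x m i j * T m l x) - (\<Sum>m\<in>UNIV. \<Gamma> x m i l * T j m x)"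

lemma pderivative_smooth:
  assumes "x \<in> S" "smooth_on S f" "smooth_on S f'"
  shows "pderivative i (\<lambda>y. f y + f' y) x = pderivative i f x + pderivative i f' x"
    "pderivative i (\<lambda>y. f y - f' y) x = pderivative i f x - pderivative i f' x"
    "pderivative i (\<lambda>y. f y * f' y) x = f x * pderivative i f' x + pderivative i f x * f' x"
  using assms by (auto intro!: pderivative_add pderivative_diff pderivative_mult)

lemma pderivative_smooth_sum:
  assumes "x \<in> S" "\<And>a. smooth_on S (f a)"
  shows "pderivative i (\<lambda>y. \<Sum>a\<in>I. f a y) x = (\<Sum>a\<in>I. pderivative i (f a) x)"
  using assms by (auto intro!: pderivative_sum)

lemma pderivative_smooth_sum_mult:
  assumes "x \<in> S" "\<And>a. smooth_on S (f a)" "\<And>a. smooth_on S (f' a)"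
  shows "pderivative i (\<lambda>y. \<Sum>a\<in>I. f a y * f' a y) x
    = (\<Sum>a\<in>I. f a x * pderivative i (f' a) x) + (\<Sum>a\<in>I. pderivative i (f a) x * f' a x)"
  using assms open_S
  by (simp add: pderivative_smooth_sum pderivative_smooth sum.distrib smooth_on_mult)

text \<open>The second partial derivatives cancel by \<open>pderivative_commute\<close> and the
  terms in \<Gamma> contracted with the first slot by vanishing torsion. What remains is the
  curvature, with a minus sign because it acts on a 1-form.\<close>

lemma ricci_identity:
  assumes x: "x \<in> S" and s: "\<And>j. smooth_on S (s j)"
  shows "nabla2 (nabla s) i j k x - nabla2 (nabla s) j i k x = - (\<Sum>l\<in>UNIV. riemann G x l k i j * s l x)"
proof -
  have DN: "pderivative i (nabla s j k) x = pderivative i (pderivative j (s k)) x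
      - (\<Sum>m\<in>UNIV. \<Gamma> x m j k * pderivative i (s m) x) - (\<Sum>m\<in>UNIV. pderivative i (\<lambda>y. \<Gamma> y m j k) x * s m x)"
    for i j
    unfolding nabla_def using s x open_S smooth_\<Gamma>
    by (simp add: pderivative_smooth pderivative_smooth_sum_mult smooth_on_pderivative smooth_on_sum smooth_on_mult)
  have comm: "pderivative i (pderivative j (s k)) x = pderivative j (pderivative i (s k)) x"
    using s[of k] by (intro pderivative_commute[OF open_S x]) (simp add: smooth_on_def)
  have GN: "(\<Sum>m\<in>UNIV. \<Gamma> x m i k * nabla s j m x) = (\<Sum>m\<in>UNIV. \<Gamma> x m i k * pderivative j (s m) x)
      - (\<Sum>l\<in>UNIV. (\<Sum>m\<in>UNIV. \<Gamma> x l j m * \<Gamma> x m i k) * s l x)" for i j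
    unfolding nabla_def sum_sum_mult_swap[symmetric] by (simp add: algebra_simps sum_subtractf)
  have R: "(\<Sum>l\<in>UNIV. riemann G x l k i j * s l x)
      = (\<Sum>m\<in>UNIV. pderivative i (\<lambda>y. \<Gamma> y m j k) x * s m x) - (\<Sum>m\<in>UNIV. pderivative j (\<lambda>y. \<Gamma> y m i k) x * s m x)
       + (\<Sum>l\<in>UNIV. (\<Sum>m\<in>UNIV. \<Gamma> x l i m * \<Gamma> x m j k) * s l x) - (\<Sum>l\<in>UNIV. (\<Sum>m\<in>UNIV. \<Gamma> x l j m * \<Gamma> x m i k) * s l x)"
    unfolding riemann_def by (simp add: ring_distribs sum.distrib sum_subtractf)
  have "(\<Sum>m\<in>UNIV. \<Gamma> x m i j * nabla s m k x) = (\<Sum>m\<in>UNIV. \<Gamma> x m j i * nabla s m k x)"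
    using levi_civita(1)[OF x] by simp
  then show ?thesis unfolding nabla2_def DN GN R comm by simp
qed

lemma nabla2_mult:
  assumes x: "x \<in> S" and s: "\<And>j. smooth_on S (s j)" and r: "\<And>j. smooth_on S (r j)"
  shows "nabla2 (\<lambda>j k y. s j y * r k y) i j k x = s j x * nabla r i k x + nabla s i j x * r k x"
  using s r x
  by (simp add: nabla2_def nabla_def pderivative_smooth algebra_simps sum_distrib_left)

lemma nabla2_scaled_metric:
  assumes x: "x \<in> S" and f: "smooth_on S f"
  shows "nabla2 (\<lambda>j k y. f y * G y $ j $ k) i j k x = pderivative i f x * G x $ j $ k"
  using f x smooth_G pderivative_G[OF x, of i j k]
  by (simp add: nabla2_def pderivative_smooth algebra_simps sum_distrib_left)

lemma nabla2_add:
  assumes x: "x \<in> S" and "\<And>j k. smooth_on S (T j k)" "\<And>j k. smooth_on S (U j k)"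
  shows "nabla2 (\<lambda>j k y. T j k y + U j k y) i j k x = nabla2 T i j k x + nabla2 U i j k x"
  using assms by (simp add: nabla2_def pderivative_smooth algebra_simps sum.distrib)

lemma nabla2_diff:
  assumes x: "x \<in> S" and "\<And>j k. smooth_on S (T j k)" "\<And>j k. smooth_on S (U j k)"
  shows "nabla2 (\<lambda>j k y. T j k y - U j k y) i j k x = nabla2 T i j k x - nabla2 U i j k x"
  using assms by (simp add: nabla2_def pderivative_smooth algebra_simps sum_subtractf)

lemma nabla2_cmult:
  assumes x: "x \<in> S" and "\<And>j k. smooth_on S (T j k)"
  shows "nabla2 (\<lambda>j k y. c * T j k y) i j k x = c * nabla2 T i j k x"
  using assms smooth_on_const[of S c] by (simp add: nabla2_def pderivative_smooth algebra_simps sum_distrib_left)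

lemma nabla2_cong:
  assumes R: "open R" "x \<in> R" and eq: "\<And>j k y. y \<in> R \<Longrightarrow> T j k y = U j k y"
  shows "nabla2 T i j k x = nabla2 U i j k x"
  using pderivative_cong[OF R eq] eq[OF R(2)] by (simp add: nabla2_def)

text \<open>Covariant differentiation commutes with lowering an index and with contraction;
  \<open>M\<close> is \<open>T\<close> with its second index raised.\<close>

lemma pderivative_trace:
  assumes x: "x \<in> S" and M: "\<And>i l. smooth_on S (M i l)"
    and T: "\<And>i a y. y \<in> S \<Longrightarrow> T i a y = (\<Sum>l\<in>UNIV. G y $ a $ l * M i l y)"
  shows "pderivative k (\<lambda>y. \<Sum>l\<in>UNIV. M l l y) x = (\<Sum>i\<in>UNIV. \<Sum>a\<in>UNIV. H x $ i $ a * nabla2 T k i a x)"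
proof -
  \<comment> \<open>The covariant derivative of the endomorphism field \<open>M\<close>.\<close>
  define W where "W i l = pderivative k (M i l) x + (\<Sum>m\<in>UNIV. \<Gamma> x l k m * M i m x) - (\<Sum>m\<in>UNIV. \<Gamma> x m k i * M m l x)" for i l
  have nT: "nabla2 T k i a x = (\<Sum>l\<in>UNIV. G x $ a $ l * W i l)" for i a
  proof -
    have "nabla2 T k i a x = nabla2 (\<lambda>i a y. \<Sum>l\<in>UNIV. G y $ a $ l * M i l y) k i a x"
      by (rule nabla2_cong[OF open_S x T])
    also have "\<dots> = (\<Sum>l\<in>UNIV. G x $ a $ l * pderivative k (M i l) x)
        + (\<Sum>l\<in>UNIV. ((\<Sum>m\<in>UNIV. \<Gamma> x m k a * G x $ m $ l) + (\<Sum>m\<in>UNIV. \<Gamma> x m k l * G x $ a $ m)) * M i l x)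
        - (\<Sum>m\<in>UNIV. \<Gamma> x m k i * (\<Sum>l\<in>UNIV. G x $ a $ l * M m l x))
        - (\<Sum>m\<in>UNIV. \<Gamma> x m k a * (\<Sum>l\<in>UNIV. G x $ m $ l * M i l x))"
      unfolding nabla2_def using x M smooth_G by (simp add: pderivative_smooth_sum_mult pderivative_G)
    also have "(\<Sum>m\<in>UNIV. \<Gamma> x m k a * (\<Sum>l\<in>UNIV. G x $ m $ l * M i l x))
        = (\<Sum>l\<in>UNIV. (\<Sum>m\<in>UNIV. \<Gamma> x m k a * G x $ m $ l) * M i l x)"
      by (subst sum_sum_mult_swap) (simp add: mult.commute)
    also have "(\<Sum>m\<in>UNIV. \<Gamma> x m k i * (\<Sum>l\<in>UNIV. G x $ a $ l * M m l x))
        = (\<Sum>l\<in>UNIV. G x $ a $ l * (\<Sum>m\<in>UNIV. \<Gamma> x m k i * M m l x))"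
      by (simp add: sum_distrib_left mult_ac, rule sum.swap)
    also have "(\<Sum>l\<in>UNIV. ((\<Sum>m\<in>UNIV. \<Gamma> x m k a * G x $ m $ l) + (\<Sum>m\<in>UNIV. \<Gamma> x m k l * G x $ a $ m)) * M i l x)
        = (\<Sum>l\<in>UNIV. (\<Sum>m\<in>UNIV. \<Gamma> x m k a * G x $ m $ l) * M i l x)
         + (\<Sum>l\<in>UNIV. G x $ a $ l * (\<Sum>m\<in>UNIV. \<Gamma> x l k m * M i m x))"
      using sum_sum_mult_swap[of "\<lambda>l. G x $ a $ l" "\<lambda>m l. \<Gamma> x l k m" "\<lambda>m. M i m x"]
      by (simp add: ring_distribs sum.distrib)
    finally show ?thesis by (simp add: W_def algebra_simps sum.distrib sum_subtractf)
  qed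
  have "(\<Sum>i\<in>UNIV. \<Sum>a\<in>UNIV. H x $ i $ a * nabla2 T k i a x) = (\<Sum>i\<in>UNIV. W i i)"
    unfolding nT by (simp add: raise_lower[OF x])
  also have "\<dots> = (\<Sum>i\<in>UNIV. pderivative k (M i i) x)"
  proof -
    \<comment> \<open>The two connection terms of \<open>W\<close> cancel under the trace.\<close>
    have "(\<Sum>i\<in>UNIV. \<Sum>m\<in>UNIV. \<Gamma> x i k m * M i m x) = (\<Sum>i\<in>UNIV. \<Sum>m\<in>UNIV. \<Gamma> x m k i * M m i x)"
      by (rule sum.swap)
    then show ?thesis by (simp add: W_def sum.distrib sum_subtractf)
  qed
  also have "\<dots> = pderivative k (\<lambda>y. \<Sum>l\<in>UNIV. M l l y) x"
    using x M by (simp add: pderivative_smooth_sum)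
  finally show ?thesis by simp
qed

end

section \<open>Conformally flat metrics\<close>

lemma christoffel_cong:
  assumes "open S" "x \<in> S" "\<And>y. y \<in> S \<Longrightarrow> G y = G' y"
  shows "christoffel G x k i j = christoffel G' x k i j"
proof -
  have "pderivative a (\<lambda>y. G y $ b $ c) x = pderivative a (\<lambda>y. G' y $ b $ c) x" for a b c
    using assms by (intro pderivative_cong[OF assms(1,2)]) simp
  then show ?thesis using assms by (simp add: christoffel_def)
qed

lemma riemann_cong:
  assumes "open S" "x \<in> S" "\<And>y. y \<in> S \<Longrightarrow> G y = G' y"
  shows "riemann G x l k i j = riemann G' x l k i j"
proof -
  have *: "christoffel G y a b c = christoffel G' y a b c" if "y \<in> S" for y a b c
    using assms that by (intro christoffel_cong[of S]) auto
  have "pderivative d (\<lambda>y. christoffel G y a b c) x = pderivative d (\<lambda>y. christoffel G' y a b c) x" for a b c d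
    using * by (intro pderivative_cong[OF assms(1,2)]) simp
  then show ?thesis using * assms(2) by (simp add: riemann_def)
qed

lemma matrix_inv_unique:
  fixes M :: "real^'m::finite^'m"
  assumes "M ** B = mat 1" "B ** M = mat 1"
  shows "matrix_inv M = B"
proof -
  have "invertible M" using assms unfolding invertible_def by blast
  have "matrix_inv M = matrix_inv M ** (M ** B)" by (simp add: assms)
  also have "\<dots> = B" using matrix_inv_works[OF \<open>invertible M\<close>] by (simp add: matrix_mul_assoc)
  finally show ?thesis .
qed

lemma matrix_inv_scaleR:
  fixes M :: "real^'m::finite^'m"
  assumes "invertible M" "c \<noteq> 0"
  shows "matrix_inv (c *\<^sub>R M) = inverse c *\<^sub>R matrix_inv M"
  using assms matrix_inv_works[OF assms(1)]
  by (intro matrix_inv_unique) (simp_all add: matrix_scalar_ac scalar_matrix_assoc[symmetric])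

locale conformally_flat_chart = metric_chart S G
  for S :: "(real^'n::finite) set" and G :: "real^'n \<Rightarrow> real^'n^'n" +
  fixes \<sigma> :: "real^'n \<Rightarrow> real"
  assumes smooth_\<sigma>: "smooth_on S \<sigma>"
    and flat: "\<And>x l k i j. x \<in> S \<Longrightarrow> riemann (\<lambda>y. exp (2 * \<sigma> y) *\<^sub>R G y) x l k i j = 0"
begin

section \<open>The gradient of the conformal exponent and the Schouten tensor\<close>

definition s :: "'n \<Rightarrow> real^'n \<Rightarrow> real" where
  "s i = pderivative i \<sigma>"

text \<open>The gradient of \<sigma> with respect to \<open>G\<close>. Below, \<open>sq\<close> is
  its squared length, of either sign, and \<open>nabla_u\<close> its covariant derivative.\<close>

definition u :: "'n \<Rightarrow> real^'n \<Rightarrow> real" where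
  "u k x = (\<Sum>m\<in>UNIV. H x $ k $ m * s m x)"

definition sq :: "real^'n \<Rightarrow> real" where
  "sq x = (\<Sum>m\<in>UNIV. u m x * s m x)"

definition nabla_u :: "'n \<Rightarrow> 'n \<Rightarrow> real^'n \<Rightarrow> real" where
  "nabla_u i l x = pderivative i (u l) x + (\<Sum>m\<in>UNIV. \<Gamma> x l i m * u m x)"

text \<open>\<open>T\<close> is the Schouten tensor of \<open>G\<close>: that of the flat metric \<open>exp (2\<sigma>) G\<close> vanishes, and \<open>T\<close> is the correction
  term in its conformal transformation law. In \<open>T_mixed\<close> the second index is raised.\<close>

definition T :: "'n \<Rightarrow> 'n \<Rightarrow> real^'n \<Rightarrow> real" where
  "T i j x = nabla s i j x - s i x * s j x + sq x / 2 * G x $ i $ j"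

definition T_mixed :: "'n \<Rightarrow> 'n \<Rightarrow> real^'n \<Rightarrow> real" where
  "T_mixed i l x = nabla_u i l x - s i x * u l x + sq x / 2 * kronecker i l"

definition trace_T :: "real^'n \<Rightarrow> real" where
  "trace_T x = (\<Sum>l\<in>UNIV. T_mixed l l x)"

lemma smooth_s: "smooth_on S (s i)"
  unfolding s_def by (intro smooth_on_pderivative smooth_\<sigma>)

lemma smooth_u: "smooth_on S (u k)"
  unfolding u_def by (intro smooth_on_sum smooth_on_mult smooth_H smooth_s open_S)

lemma smooth_sq: "smooth_on S sq"
  unfolding sq_def by (intro smooth_on_sum smooth_on_mult smooth_u smooth_s open_S)

lemma smooth_T: "smooth_on S (T i j)"
  unfolding T_def
  by (intro smooth_on_add smooth_on_diff smooth_on_mult smooth_on_divide smooth_nabla smooth_s smooth_sq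
      smooth_G smooth_on_const open_S) simp

lemma smooth_T_mixed: "smooth_on S (T_mixed i l)"
  unfolding T_mixed_def nabla_u_def
  by (intro smooth_on_add smooth_on_diff smooth_on_mult smooth_on_divide smooth_on_sum smooth_on_pderivative
      smooth_u smooth_s smooth_sq smooth_\<Gamma> smooth_on_const open_S) simp

lemma smooth_trace_T: "smooth_on S trace_T"
  unfolding trace_T_def by (intro smooth_on_sum smooth_T_mixed open_S)

lemma G_u: "x \<in> S \<Longrightarrow> (\<Sum>m\<in>UNIV. G x $ i $ m * u m x) = s i x"
  unfolding u_def by (rule lower_raise)

lemma pderivative_s_commute: "x \<in> S \<Longrightarrow> pderivative i (s j) x = pderivative j (s i) x"
  unfolding s_def using smooth_\<sigma> by (intro pderivative_commute[OF open_S]) (simp_all add: smooth_on_def)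

lemma nabla_s_commute: "x \<in> S \<Longrightarrow> nabla s i j x = nabla s j i x"
  using levi_civita(1) pderivative_s_commute by (simp add: nabla_def)

lemma T_commute: "x \<in> S \<Longrightarrow> T i j x = T j i x"
  using nabla_s_commute G_commute by (simp add: T_def)

text \<open>Differentiate \<open>G_u\<close> and rewrite the derivative of the metric by
  \<open>pderivative_G\<close>: since the metric is parallel, lowering an index commutes with
  covariant differentiation.\<close>

lemma G_nabla_u:
  assumes x: "x \<in> S"
  shows "(\<Sum>l\<in>UNIV. G x $ a $ l * nabla_u i l x) = nabla s i a x"
proof -
  have "pderivative i (s a) x = pderivative i (\<lambda>y. \<Sum>l\<in>UNIV. G y $ a $ l * u l y) x"
    by (rule pderivative_cong[OF open_S x]) (simp add: G_u)
  also have "\<dots> = (\<Sum>l\<in>UNIV. G x $ a $ l * pderivative i (u l) x)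
     + (\<Sum>l\<in>UNIV. ((\<Sum>m\<in>UNIV. \<Gamma> x m i a * G x $ m $ l) + (\<Sum>m\<in>UNIV. \<Gamma> x m i l * G x $ a $ m)) * u l x)"
    using x smooth_G smooth_u by (simp add: pderivative_smooth_sum_mult pderivative_G)
  also have "(\<Sum>l\<in>UNIV. ((\<Sum>m\<in>UNIV. \<Gamma> x m i a * G x $ m $ l) + (\<Sum>m\<in>UNIV. \<Gamma> x m i l * G x $ a $ m)) * u l x)
     = (\<Sum>m\<in>UNIV. \<Gamma> x m i a * s m x) + (\<Sum>l\<in>UNIV. G x $ a $ l * (\<Sum>m\<in>UNIV. \<Gamma> x l i m * u m x))"
    using sum_sum_mult_swap'[of "\<lambda>m. \<Gamma> x m i a" "\<lambda>l m. G x $ m $ l" "\<lambda>l. u l x"]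
      sum_sum_mult_swap[of "\<lambda>l. G x $ a $ l" "\<lambda>m l. \<Gamma> x l i m" "\<lambda>m. u m x"]
    by (simp add: ring_distribs sum.distrib G_u[OF x])
  finally show ?thesis by (simp add: nabla_def nabla_u_def ring_distribs sum.distrib)
qed

lemma G_T_mixed: "x \<in> S \<Longrightarrow> (\<Sum>l\<in>UNIV. G x $ a $ l * T_mixed i l x) = T i a x"
  using sum_distrib_left[of "s i x" "\<lambda>l. G x $ a $ l * u l x" UNIV, symmetric]
    sum_distrib_left[of "sq x / 2" "\<lambda>l. G x $ a $ l * kronecker i l" UNIV, symmetric]
  by (simp add: T_mixed_def T_def ring_distribs sum.distrib sum_subtractf G_nabla_u mult.left_commute G_u G_commute[of x a i])

lemma T_mixed_eq: "x \<in> S \<Longrightarrow> T_mixed i l x = (\<Sum>a\<in>UNIV. H x $ l $ a * T i a x)"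
  using raise_lower[of x l "\<lambda>l. T_mixed i l x"] by (simp add: G_T_mixed)

text \<open>The difference tensor between the Levi-Civita connections of
  \<open>exp (2\<sigma>) G\<close> and \<open>G\<close>.\<close>

definition E :: "'n \<Rightarrow> 'n \<Rightarrow> 'n \<Rightarrow> real^'n \<Rightarrow> real" where
  "E l j k x = kronecker l j * s k x + kronecker l k * s j x - G x $ j $ k * u l x"

lemma smooth_E: "smooth_on S (E l j k)"
  unfolding E_def
  by (intro smooth_on_diff smooth_on_add smooth_on_mult smooth_on_const smooth_s smooth_u smooth_G open_S)

text \<open>The exponential factor cancels between the inverse metric and the derivatives of the
  metric. The extra terms come from differentiating that factor, and raising their index with
  \<open>H\<close> yields \<open>E\<close>.\<close>

lemma christoffel_conformal:
  assumes x: "x \<in> S"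
  shows "christoffel (\<lambda>y. exp (2 * \<sigma> y) *\<^sub>R G y) x k i j = \<Gamma> x k i j + E k i j x"
proof -
  have d\<sigma>: "(\<lambda>y. 2 * \<sigma> y) differentiable (at x)"
    using smooth_\<sigma> x by (auto intro!: smooth_on_mult open_S)
  have dexp: "(\<lambda>y. exp (2 * \<sigma> y)) differentiable (at x)"
    using has_derivative_exp[OF has_derivative_frechet[OF d\<sigma>]] by (auto simp: differentiable_def)
  have "pderivative a (\<lambda>y. 2 * \<sigma> y) x = 2 * s a x" for a
    using pderivative_smooth(3)[OF x smooth_on_const[of S 2] smooth_\<sigma>] by (simp add: s_def)
  then have "pderivative a (\<lambda>y. exp (2 * \<sigma> y) * G y $ b $ c) x
      = exp (2 * \<sigma> x) * pderivative a (\<lambda>y. G y $ b $ c) x + exp (2 * \<sigma> x) * (2 * s a x) * G x $ b $ c" for a b c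
    by (simp only: pderivative_mult[OF dexp smooth_differentiable[OF smooth_G x]] pderivative_exp[OF d\<sigma>])
  then have D: "pderivative a (\<lambda>y. (exp (2 * \<sigma> y) *\<^sub>R G y) $ b $ c) x
      = exp (2 * \<sigma> x) * (pderivative a (\<lambda>y. G y $ b $ c) x + 2 * (s a x * G x $ b $ c))" for a b c
    by (simp add: distrib_left)
  have inv: "matrix_inv (exp (2 * \<sigma> x) *\<^sub>R G x) = inverse (exp (2 * \<sigma> x)) *\<^sub>R H x"
    by (intro matrix_inv_scaleR inv_G x) simp
  have sums: "(\<Sum>m\<in>UNIV. H x $ k $ m * (s a x * G x $ b $ m)) = kronecker k b * s a x" for a b
  proof -
    have "(\<Sum>m\<in>UNIV. H x $ k $ m * (s a x * G x $ b $ m)) = (\<Sum>m\<in>UNIV. H x $ k $ m * G x $ m $ b) * s a x"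
      by (simp add: sum_distrib_left mult_ac G_commute[OF x, of b])
    then show ?thesis by (simp add: HG[OF x])
  qed
  have sums': "(\<Sum>m\<in>UNIV. H x $ k $ m * (s m x * G x $ i $ j)) = G x $ i $ j * u k x"
    by (simp add: u_def sum_distrib_left mult_ac)
  have cancel: "(inverse (exp z) *\<^sub>R H x) $ k $ m * (exp z * p + exp z * q - exp z * r) = H x $ k $ m * (p + q - r)"
    for z m p q r
    by (simp add: field_simps)
  have "christoffel (\<lambda>y. exp (2 * \<sigma> y) *\<^sub>R G y) x k i j = (\<Sum>m\<in>UNIV. H x $ k $ m *
     ((pderivative i (\<lambda>y. G y $ j $ m) x + pderivative j (\<lambda>y. G y $ i $ m) x - pderivative m (\<lambda>y. G y $ i $ j) x)
      + 2 * (s i x * G x $ j $ m) + 2 * (s j x * G x $ i $ m) - 2 * (s m x * G x $ i $ j))) / 2"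
    unfolding christoffel_def inv D cancel by (simp add: algebra_simps)
  also have "\<dots> = \<Gamma> x k i j + (\<Sum>m\<in>UNIV. H x $ k $ m * (s i x * G x $ j $ m))
      + (\<Sum>m\<in>UNIV. H x $ k $ m * (s j x * G x $ i $ m)) - (\<Sum>m\<in>UNIV. H x $ k $ m * (s m x * G x $ i $ j))"
    unfolding christoffel_def by (simp add: algebra_simps sum.distrib sum_subtractf sum_distrib_left add_divide_distrib diff_divide_distrib sum_divide_distrib)
  finally show ?thesis unfolding sums sums' E_def by simp
qed

text \<open>Insert \<Gamma> + \<open>E\<close> into the curvature of the flat metric
  \<open>exp (2\<sigma>) G\<close>, which vanishes, and solve for the curvature of \<open>G\<close>.
  The derivatives of \<open>E\<close> and its products with \<Gamma> combine into covariant
  derivatives; the products of \<open>E\<close> with itself give the quadratic terms of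
  \<open>T\<close>.\<close>

lemma riemann_eq:
  assumes x: "x \<in> S"
  shows "riemann G x l k i j = kronecker l i * T j k x - kronecker l j * T i k x
    + G x $ j $ k * T_mixed i l x - G x $ i $ k * T_mixed j l x"
proof -
  have DE: "pderivative i (\<lambda>y. christoffel (\<lambda>y. exp (2 * \<sigma> y) *\<^sub>R G y) y l j k) x
     = pderivative i (\<lambda>y. \<Gamma> y l j k) x + kronecker l j * pderivative i (s k) x + kronecker l k * pderivative i (s j) x
       - G x $ j $ k * pderivative i (u l) x
       - ((\<Sum>m\<in>UNIV. \<Gamma> x m i j * G x $ m $ k) + (\<Sum>m\<in>UNIV. \<Gamma> x m i k * G x $ j $ m)) * u l x" for i j
  proof -
    have "pderivative i (\<lambda>y. christoffel (\<lambda>y. exp (2 * \<sigma> y) *\<^sub>R G y) y l j k) x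
      = pderivative i (\<lambda>y. \<Gamma> y l j k + E l j k y) x"
      by (rule pderivative_cong[OF open_S x]) (rule christoffel_conformal)
    also have "\<dots> = pderivative i (\<lambda>y. \<Gamma> y l j k) x + pderivative i (E l j k) x"
      using x smooth_\<Gamma> smooth_E by (simp add: pderivative_smooth)
    also have "pderivative i (E l j k) x = kronecker l j * pderivative i (s k) x + kronecker l k * pderivative i (s j) x
       - G x $ j $ k * pderivative i (u l) x
       - ((\<Sum>m\<in>UNIV. \<Gamma> x m i j * G x $ m $ k) + (\<Sum>m\<in>UNIV. \<Gamma> x m i k * G x $ j $ m)) * u l x"
      unfolding E_def using x smooth_s smooth_u smooth_G open_S
      by (simp add: pderivative_smooth smooth_on_add smooth_on_mult smooth_on_const pderivative_G)
    finally show ?thesis by simp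
  qed
  have \<Gamma>E: "(\<Sum>m\<in>UNIV. \<Gamma> x l i m * E m j k x) = \<Gamma> x l i j * s k x + \<Gamma> x l i k * s j x
      - G x $ j $ k * (\<Sum>m\<in>UNIV. \<Gamma> x l i m * u m x)" for i j
    using sum_distrib_right[of "\<lambda>m. \<Gamma> x l i m * kronecker m j" UNIV "s k x"]
      sum_distrib_right[of "\<lambda>m. \<Gamma> x l i m * kronecker m k" UNIV "s j x"]
    by (simp add: E_def algebra_simps sum.distrib sum_subtractf sum_distrib_left)
  have E\<Gamma>: "(\<Sum>m\<in>UNIV. E l i m x * \<Gamma> x m j k) = kronecker l i * (\<Sum>m\<in>UNIV. \<Gamma> x m j k * s m x) + s i x * \<Gamma> x l j k
      - u l x * (\<Sum>m\<in>UNIV. \<Gamma> x m j k * G x $ i $ m)" for i j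
    using sum_distrib_right[of "\<lambda>m. kronecker l m * \<Gamma> x m j k" UNIV "s i x"]
    by (simp add: E_def algebra_simps sum.distrib sum_subtractf sum_distrib_left)
  have Eu: "(\<Sum>m\<in>UNIV. E l i m x * u m x) = kronecker l i * sq x" for i
    using sum_distrib_right[of "\<lambda>m. kronecker l m * u m x" UNIV "s i x"] G_u[OF x, of i, THEN arg_cong, of "\<lambda>t. t * u l x"]
    by (simp add: E_def sq_def algebra_simps sum.distrib sum_subtractf sum_distrib_left)
  have EE: "(\<Sum>m\<in>UNIV. E l i m x * E m j k x) = E l i j x * s k x + E l i k x * s j x - G x $ j $ k * (kronecker l i * sq x)" for i j
    using sum_distrib_right[of "\<lambda>m. E l i m x * kronecker m j" UNIV "s k x"]
      sum_distrib_right[of "\<lambda>m. E l i m x * kronecker m k" UNIV "s j x"] Eu[of i, THEN arg_cong, of "\<lambda>t. G x $ j $ k * t"]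
    by (simp add: E_def[of _ j k] algebra_simps sum.distrib sum_subtractf sum_distrib_left)
  have *: "(\<Sum>m\<in>UNIV. (\<Gamma> x l i m + E l i m x) * (\<Gamma> x m j k + E m j k x))
     = (\<Sum>m\<in>UNIV. \<Gamma> x l i m * \<Gamma> x m j k) + (\<Sum>m\<in>UNIV. \<Gamma> x l i m * E m j k x)
       + (\<Sum>m\<in>UNIV. E l i m x * \<Gamma> x m j k) + (\<Sum>m\<in>UNIV. E l i m x * E m j k x)" for i j
    by (simp add: ring_distribs sum.distrib)
  have R: "riemann G x l k i j = pderivative i (\<lambda>y. \<Gamma> y l j k) x - pderivative j (\<lambda>y. \<Gamma> y l i k) x
    + (\<Sum>m\<in>UNIV. \<Gamma> x l i m * \<Gamma> x m j k) - (\<Sum>m\<in>UNIV. \<Gamma> x l j m * \<Gamma> x m i k)"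
    by (simp add: riemann_def sum_subtractf)
  have GG: "(\<Sum>m\<in>UNIV. \<Gamma> x m i j * G x $ m $ k) = (\<Sum>m\<in>UNIV. \<Gamma> x m j i * G x $ m $ k)"
    using levi_civita(1)[OF x] by simp
  have "riemann (\<lambda>y. exp (2 * \<sigma> y) *\<^sub>R G y) x l k i j = 0" by (rule flat[OF x])
  then show ?thesis
    unfolding R riemann_def DE sum_subtractf christoffel_conformal[OF x] * \<Gamma>E E\<Gamma> EE
      T_def T_mixed_def nabla_def nabla_u_def GG
    by (simp add: E_def G_commute[OF x, of j i] levi_civita(1)[OF x, of l j i] kronecker_commute[of _ l]
        pderivative_s_commute[OF x, of j i] algebra_simps)
qed

lemma ricci_eq:
  assumes x: "x \<in> S"
  shows "ricci G x $ j $ k = (real CARD('n) - 2) * T j k x + trace_T x * G x $ j $ k"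
proof -
  have "ricci G x $ j $ k = (\<Sum>i\<in>UNIV. T j k x - kronecker i j * T i k x
    + G x $ j $ k * T_mixed i i x - G x $ k $ i * T_mixed j i x)"
    by (simp add: ricci_def riemann_eq[OF x] G_commute[OF x, of _ k])
  also have "\<dots> = real CARD('n) * T j k x - T j k x + trace_T x * G x $ j $ k - T j k x"
    by (simp add: sum.distrib sum_subtractf G_T_mixed[OF x] trace_T_def sum_distrib_left mult.commute)
  finally show ?thesis by (simp add: algebra_simps)
qed

lemma riemann_contract:
  assumes x: "x \<in> S"
  shows "(\<Sum>l\<in>UNIV. riemann G x l k i j * w l) = w i * T j k x - w j * T i k x
    + G x $ j $ k * (\<Sum>l\<in>UNIV. T_mixed i l x * w l) - G x $ i $ k * (\<Sum>l\<in>UNIV. T_mixed j l x * w l)"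
  using sum_distrib_right[of "\<lambda>m. kronecker m i * w m" UNIV "T j k x"]
     sum_distrib_right[of "\<lambda>m. kronecker m j * w m" UNIV "T i k x"]
  by (simp add: riemann_eq[OF x] algebra_simps sum.distrib sum_subtractf sum_distrib_left)

text \<open>Antisymmetrising the derivative of \<open>T\<close> turns the third derivatives of
  \<sigma> into curvature by the Ricci identity. With \<open>riemann_eq\<close> that curvature is
  again expressed through \<open>T\<close>, and the lower-order terms cancel. This direct
  computation, in place of the Bianchi identity, covers dimension 3.\<close>

lemma cotton_zero:
  assumes x: "x \<in> S"
  shows "nabla2 T i j k x = nabla2 T j i k x"
proof -
  define n where "n i = (\<Sum>l\<in>UNIV. nabla s i l x * u l x)" for i
  have nu: "(\<Sum>l\<in>UNIV. nabla_u i l x * s l x) = n i" for i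
  proof -
    have "(\<Sum>l\<in>UNIV. nabla_u i l x * s l x) = (\<Sum>l\<in>UNIV. nabla_u i l x * (\<Sum>m\<in>UNIV. G x $ l $ m * u m x))"
      by (simp add: G_u[OF x])
    also have "\<dots> = (\<Sum>m\<in>UNIV. (\<Sum>l\<in>UNIV. G x $ l $ m * nabla_u i l x) * u m x)"
      by (rule sum_sum_mult_swap)
    also have "\<dots> = n i"
      using G_nabla_u[OF x] by (simp add: n_def G_commute[OF x])
    finally show ?thesis .
  qed
  \<comment> \<open>Product rule for the pairing of \<open>u\<close> with \<open>s\<close>; the
    connection terms of the two factors cancel.\<close>
  have Dq: "pderivative i sq x = 2 * n i" for i
  proof -
    have "pderivative i sq x = (\<Sum>m\<in>UNIV. u m x * pderivative i (s m) x) + (\<Sum>m\<in>UNIV. pderivative i (u m) x * s m x)"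
      unfolding sq_def using x smooth_u smooth_s by (rule pderivative_smooth_sum_mult)
    moreover have "(\<Sum>m\<in>UNIV. u m x * pderivative i (s m) x) = n i + (\<Sum>m\<in>UNIV. u m x * (\<Sum>l\<in>UNIV. \<Gamma> x l i m * s l x))"
      by (simp add: n_def nabla_def algebra_simps sum_subtractf)
    moreover have "(\<Sum>m\<in>UNIV. pderivative i (u m) x * s m x) = n i - (\<Sum>l\<in>UNIV. (\<Sum>m\<in>UNIV. \<Gamma> x l i m * u m x) * s l x)"
      by (simp add: nu[symmetric] nabla_u_def algebra_simps sum.distrib)
    ultimately show ?thesis by (simp add: sum_sum_mult_swap)
  qed
  have W: "(\<Sum>l\<in>UNIV. T_mixed i l x * s l x) = n i - s i x * sq x / 2" for i
  proof -
    have "T_mixed i l x * s l x = nabla_u i l x * s l x - s i x * (u l x * s l x) + sq x / 2 * (kronecker i l * s l x)" for l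
      by (simp add: T_mixed_def algebra_simps)
    then show ?thesis
      by (simp only: sum.distrib sum_subtractf sum_distrib_left[symmetric] nu sum_kronecker sq_def[symmetric]) simp
  qed
  have nT: "nabla2 T i j k x = nabla2 (nabla s) i j k x - (s j x * nabla s i k x + nabla s i j x * s k x)
      + n i * G x $ j $ k" for i j
  proof -
    have sm: "smooth_on S (nabla s a b)" "smooth_on S (\<lambda>y. s a y * s b y)" "smooth_on S (\<lambda>y. sq y / 2)"
       "smooth_on S (\<lambda>y. sq y / 2 * G y $ a $ b)" "smooth_on S (\<lambda>y. nabla s a b y - s a y * s b y)" for a b
      by (intro smooth_nabla smooth_s smooth_on_mult smooth_on_divide smooth_on_diff smooth_on_const smooth_sq smooth_G open_S, simp?)+
    have "pderivative i (\<lambda>y. sq y / 2) x = n i"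
      using pderivative_smooth(3)[OF x smooth_sq smooth_on_const[of S "1/2"], of i] Dq[of i] by simp
    then show ?thesis unfolding T_def
      by (subst nabla2_add[OF x sm(5,4)], subst nabla2_diff[OF x sm(1,2)], subst nabla2_mult[of x s s, OF x smooth_s smooth_s],
          subst nabla2_scaled_metric[OF x sm(3)]) simp
  qed
  have "nabla2 (nabla s) i j k x = nabla2 (nabla s) j i k x - (\<Sum>l\<in>UNIV. riemann G x l k i j * s l x)"
    using ricci_identity[of x s, OF x smooth_s, of i j k] by simp
  then show ?thesis
    unfolding nT riemann_contract[OF x] W T_def
    using nabla_s_commute[OF x, of i j] by (simp add: field_simps)
qed

end

section \<open>The recurrence equation at a point\<close>

lemma obtain_other_two:
  fixes a :: "'n::finite"
  assumes "CARD('n) \<ge> 3"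
  obtains b d where "b \<noteq> a" "d \<noteq> a" "b \<noteq> d"
proof -
  have ex: "\<exists>b. b \<notin> X" if "card X < CARD('n)" for X :: "'n set"
    using that by (metis UNIV_eq_I less_irrefl)
  obtain b where b: "b \<notin> {a}" using ex[of "{a}"] assms by auto
  obtain d where "d \<notin> {a, b}" using ex[of "{a, b}"] b assms by auto
  then show ?thesis using b that by blast
qed

text \<open>A form with an inverse \<open>h\<close> is not zero: contracting \<open>C * g\<close>
  with \<open>h\<close> returns \<open>C\<close>.\<close>

lemma degenerate_form_zero:
  fixes g h :: "'n::finite \<Rightarrow> 'n \<Rightarrow> real" and C :: real
  assumes "\<And>i j. (\<Sum>m\<in>UNIV. g i m * h m j) = kronecker i j"
    and "\<And>i j. C * g i j = 0"
  shows "C = 0"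
proof -
  have "(\<Sum>m\<in>UNIV. (C * g i m) * h m i) = C" for i
    using assms(1)[of i i] by (simp add: sum_distrib_left[symmetric] mult.assoc)
  then show ?thesis by (simp add: assms(2))
qed

text \<open>Up to the factor \<open>(A a)\<^sup>2\<close>, the form is the restriction of \<open>g\<close> to the hyperplane \<open>A = 0\<close>, evaluated on the
  projections along \<open>a\<close> of the basis vectors. It vanishes only if that hyperplane is totally isotropic, which
  nondegeneracy excludes in dimension at least 3.\<close>

lemma hyperplane_form_nonzero:
  fixes g h :: "'n::finite \<Rightarrow> 'n \<Rightarrow> real" and A :: "'n \<Rightarrow> real"
  assumes n: "CARD('n) \<ge> 3" and gh: "\<And>i j. (\<Sum>m\<in>UNIV. g i m * h m j) = kronecker i j"
    and A: "A a \<noteq> 0"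
  shows "\<exists>b c. g b c * (A a * A a) + A b * A c * g a a - A a * A c * g b a - A a * A b * g a c \<noteq> 0"
proof (rule ccontr)
  assume *: "\<not> ?thesis"
  define w where "w b = A b * g a a - A a * g b a" for b
  define A' where "A' d = (\<Sum>c\<in>UNIV. A c * h c d)" for d
  \<comment> \<open>Contract with the inverse \<open>h\<close>. For indices other than
    \<open>a\<close> this says that a nonzero multiple of the identity, of size at least 2, equals
    the rank-one matrix \<open>- A' d * w b\<close>.\<close>
  have eq: "kronecker b d * (A a * A a) + A' d * w b - A a * A b * kronecker a d = 0" for b d
  proof -
    have "0 = (\<Sum>c\<in>UNIV. (g b c * (A a * A a) + A b * A c * g a a - A a * A c * g b a - A a * A b * g a c) * h c d)"
      using * by simp
    also have "\<dots> = (\<Sum>c\<in>UNIV. g b c * h c d) * (A a * A a) + A' d * w b - A a * A b * (\<Sum>c\<in>UNIV. g a c * h c d)"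
      by (simp add: A'_def w_def algebra_simps sum.distrib sum_subtractf sum_distrib_left)
    finally show ?thesis by (simp add: gh)
  qed
  obtain b d where bd: "b \<noteq> a" "d \<noteq> a" "b \<noteq> d" using obtain_other_two[OF n] .
  have "A a * A a + A' b * w b = 0" "A a * A a + A' d * w d = 0" "A' d * w b = 0"
    using eq[of b b] eq[of d d] eq[of b d] bd by (simp_all add: kronecker_def)
  then show False using A by auto
qed

text \<open>Subtracting \<tau> \<open>g\<close> from \<open>T\<close> changes \<open>C\<close> into
  \<open>e\<close>, with \<open>e a = 0\<close>. Eliminating \<open>Q\<close> leaves a linear
  relation between rows of the nondegenerate \<open>g\<close>, which forces \<open>e = 0\<close>.
  Then each row of \<open>Q\<close> is proportional to row \<open>a\<close>, and symmetry makes
  \<open>Q\<close> a multiple of \<open>A\<close> tensor \<open>A\<close>.\<close>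

lemma recurrence_algebra:
  fixes g h T :: "'n::finite \<Rightarrow> 'n \<Rightarrow> real" and A C :: "'n \<Rightarrow> real"
  assumes n: "CARD('n) \<ge> 3" and gh: "\<And>i j. (\<Sum>m\<in>UNIV. g i m * h m j) = kronecker i j"
    and g: "\<And>i j. g i j = g j i" and T: "\<And>i j. T i j = T j i" and A: "A a \<noteq> 0"
    and eq: "\<And>i j l. A i * T j l + C i * g j l = A j * T i l + C j * g i l"
  defines "\<tau> \<equiv> - C a / A a"
  shows "C i = - \<tau> * A i" "T i j = \<tau> * g i j + (T a a - \<tau> * g a a) / (A a * A a) * (A i * A j)"
proof -
  define Q where "Q i j = T i j - \<tau> * g i j" for i j
  define e where "e i = C i + \<tau> * A i" for i
  have ea: "e a = 0" using A by (simp add: e_def \<tau>_def)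
  have eqQ: "A i * Q j l + e i * g j l = A j * Q i l + e j * g i l" for i j l
    using eq[of i j l] by (simp add: Q_def e_def algebra_simps)
  have Qa: "A a * Q i l = A i * Q a l + e i * g a l" for i l using eqQ[of i a l] ea by simp
  have e0: "e i = 0" for i
  proof (cases "i = a")
    case False
    \<comment> \<open>A third index: the rows \<open>a\<close>, \<open>i\<close> and
      \<open>k\<close> of \<open>g\<close> are then linearly independent.\<close>
    obtain k where k: "k \<noteq> a" "k \<noteq> i"
      using obtain_other_two[OF n, of a] by metis
    have *: "(A i * e j - A j * e i) * g a l + A a * (e i * g j l - e j * g i l) = 0" for j l
    proof -
      have "A a * (A i * Q j l + e i * g j l) = A a * (A j * Q i l + e j * g i l)" by (simp add: eqQ[of i j l])
      then have "A i * (A a * Q j l) + A a * e i * g j l = A j * (A a * Q i l) + A a * e j * g i l"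
        by (simp add: algebra_simps)
      then show ?thesis by (simp add: Qa algebra_simps)
    qed
    \<comment> \<open>Contraction with column \<open>k\<close> of the inverse isolates the
      coefficient of row \<open>k\<close>.\<close>
    have "0 = (\<Sum>l\<in>UNIV. ((A i * e k - A k * e i) * g a l + A a * (e i * g k l - e k * g i l)) * h l k)"
      by (simp add: *)
    also have "\<dots> = (A i * e k - A k * e i) * (\<Sum>l\<in>UNIV. g a l * h l k) + A a * e i * (\<Sum>l\<in>UNIV. g k l * h l k)
        - A a * e k * (\<Sum>l\<in>UNIV. g i l * h l k)"
      by (simp add: algebra_simps sum.distrib sum_subtractf sum_distrib_left)
    also have "\<dots> = A a * e i" using k by (simp add: gh) (simp add: kronecker_def)
    finally show ?thesis using A by simp
  qed (use ea in simp)
  show "C i = - \<tau> * A i" using e0[of i] by (simp add: e_def)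
  have "A a * Q i j = A i * Q a j" "A a * Q a j = A j * Q a a"
    using Qa[of i j] Qa[of j a] e0 g[of j a] T[of j a] by (simp_all add: Q_def)
  then have "A a * A a * Q i j = A i * A j * Q a a" by (simp add: mult.assoc mult.left_commute)
  then have "Q i j = Q a a / (A a * A a) * (A i * A j)" using A by (simp add: field_simps)
  then show "T i j = \<tau> * g i j + (T a a - \<tau> * g a a) / (A a * A a) * (A i * A j)"
    by (simp add: Q_def)
qed

section \<open>Conformally flat metrics with recurrent Ricci tensor\<close>

text \<open>The index \<open>a\<close> names one component of \<open>A\<close> without zeros on
  \<open>S\<close>, by which one can divide. Near any given point such an index exists because
  \<open>A\<close> vanishes nowhere.\<close>

locale recurrent_chart = conformally_flat_chart S G \<sigma>
  for S :: "(real^'n::finite) set" and G :: "real^'n \<Rightarrow> real^'n^'n" and \<sigma> :: "real^'n \<Rightarrow> real" +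
  fixes A B :: "real^'n \<Rightarrow> real^'n" and a :: 'n
  assumes smooth_A: "\<And>i. smooth_on S (\<lambda>x. A x $ i)"
    and smooth_B: "\<And>i. smooth_on S (\<lambda>x. B x $ i)"
    and A_nonzero: "\<And>x. x \<in> S \<Longrightarrow> A x $ a \<noteq> 0"
    and B_nonzero: "\<And>x. x \<in> S \<Longrightarrow> B x \<noteq> 0"
    and dim: "CARD('n) \<ge> 3"
    and recurrence: "\<And>x i j l. x \<in> S \<Longrightarrow> covariant_derivative (\<Gamma> x) (ricci G) x i j l
       = A x $ i * ricci G x $ j $ l + B x $ i * G x $ j $ l"
begin

definition \<tau> :: "real^'n \<Rightarrow> real" where
  "\<tau> x = - B x $ a / (2 * (real CARD('n) - 1) * A x $ a)"

definition Q :: "'n \<Rightarrow> 'n \<Rightarrow> real^'n \<Rightarrow> real" where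
  "Q i j x = T i j x - \<tau> x * G x $ i $ j"

lemma smooth_\<tau>: "smooth_on S \<tau>"
  unfolding \<tau>_def using A_nonzero dim
  by (intro smooth_on_divide smooth_on_uminus smooth_on_mult smooth_on_const smooth_A smooth_B open_S) simp_all

lemma smooth_Q: "smooth_on S (Q i j)"
  unfolding Q_def by (intro smooth_on_diff smooth_on_mult smooth_T smooth_\<tau> smooth_G open_S)

text \<open>The metric coefficient left when the recurrence of the Ricci tensor is rewritten for
  \<open>T\<close> by \<open>ricci_eq\<close> and divided by \<open>n - 2\<close>.\<close>

definition C :: "'n \<Rightarrow> real^'n \<Rightarrow> real" where
  "C i x = (A x $ i * trace_T x + B x $ i - pderivative i trace_T x) / (real CARD('n) - 2)"

lemma nabla2_T_C:
  assumes x: "x \<in> S"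
  shows "nabla2 T i j l x = A x $ i * T j l x + C i x * G x $ j $ l"
proof -
  have sm: "smooth_on S (\<lambda>y. (real CARD('n) - 2) * T j l y)" "smooth_on S (\<lambda>y. trace_T y * G y $ j $ l)" for j l
    by (intro smooth_on_mult smooth_T smooth_trace_T smooth_G smooth_on_const open_S)+
  have "covariant_derivative (\<Gamma> x) (ricci G) x i j l = nabla2 (\<lambda>j l y. ricci G y $ j $ l) i j l x"
    by (simp add: covariant_derivative_def nabla2_def)
  also have "\<dots> = nabla2 (\<lambda>j l y. (real CARD('n) - 2) * T j l y + trace_T y * G y $ j $ l) i j l x"
    by (rule nabla2_cong[OF open_S x ricci_eq])
  also have "\<dots> = (real CARD('n) - 2) * nabla2 T i j l x + pderivative i trace_T x * G x $ j $ l"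
    by (subst nabla2_add[OF x sm], subst nabla2_cmult[OF x smooth_T], subst nabla2_scaled_metric[OF x smooth_trace_T]) simp
  finally have "(real CARD('n) - 2) * nabla2 T i j l x = A x $ i * ((real CARD('n) - 2) * T j l x + trace_T x * G x $ j $ l)
      + B x $ i * G x $ j $ l - pderivative i trace_T x * G x $ j $ l"
    using recurrence[OF x, of i j l] ricci_eq[OF x, of j l] by simp
  also have "\<dots> = (real CARD('n) - 2) * (A x $ i * T j l x) + (A x $ i * trace_T x + B x $ i - pderivative i trace_T x) * G x $ j $ l"
    by (simp add: algebra_simps)
  also have "\<dots> = (real CARD('n) - 2) * (A x $ i * T j l x + C i x * G x $ j $ l)"
    using dim by (simp add: C_def distrib_left)
  finally show ?thesis using dim by simp
qed

lemma H_T: "x \<in> S \<Longrightarrow> (\<Sum>i\<in>UNIV. \<Sum>b\<in>UNIV. H x $ i $ b * T i b x) = trace_T x"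
  by (simp add: trace_T_def T_mixed_eq)

lemma H_G:
  assumes x: "x \<in> S"
  shows "(\<Sum>i\<in>UNIV. \<Sum>b\<in>UNIV. H x $ i $ b * G x $ i $ b) = real CARD('n)"
proof -
  have "(\<Sum>b\<in>UNIV. H x $ i $ b * G x $ i $ b) = 1" for i
    using HG[OF x, of i i] by (simp only: G_commute[OF x, of i] kronecker_refl)
  then show ?thesis by simp
qed

lemma pderivative_trace_T_C:
  assumes x: "x \<in> S"
  shows "pderivative k trace_T x = A x $ k * trace_T x + real CARD('n) * C k x"
proof -
  have "pderivative k trace_T x = (\<Sum>i\<in>UNIV. \<Sum>b\<in>UNIV. H x $ i $ b * nabla2 T k i b x)"
    unfolding trace_T_def by (rule pderivative_trace[OF x smooth_T_mixed]) (simp add: G_T_mixed)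
  also have "\<dots> = A x $ k * (\<Sum>i\<in>UNIV. \<Sum>b\<in>UNIV. H x $ i $ b * T i b x) + C k x * (\<Sum>i\<in>UNIV. \<Sum>b\<in>UNIV. H x $ i $ b * G x $ i $ b)"
    by (simp add: nabla2_T_C[OF x] algebra_simps sum.distrib sum_distrib_left)
  finally show ?thesis by (simp add: H_T[OF x] H_G[OF x])
qed

text \<open>The definition of \<open>C\<close> and the traced recurrence are two expressions for the
  derivative of \<open>trace_T\<close>; comparing them gives
  \<open>B = (n - 2) C + n C\<close>.\<close>

lemma B_C: "x \<in> S \<Longrightarrow> B x $ i = 2 * (real CARD('n) - 1) * C i x"
  using pderivative_trace_T_C[of x i] dim by (simp add: C_def field_simps)

lemma \<tau>_eq: "x \<in> S \<Longrightarrow> \<tau> x = - C a x / A x $ a"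
  using dim A_nonzero by (simp add: \<tau>_def B_C field_simps)

lemma
  assumes x: "x \<in> S"
  shows C_eq: "C i x = - \<tau> x * A x $ i"
    and Q_eq: "Q i j x = Q a a x / (A x $ a * A x $ a) * (A x $ i * A x $ j)"
proof -
  \<comment> \<open>The Codazzi equation becomes purely algebraic once the recurrence replaces the
    derivatives of \<open>T\<close>.\<close>
  have eq: "A x $ i * T j l x + C i x * G x $ j $ l = A x $ j * T i l x + C j x * G x $ i $ l" for i j l
    using cotton_zero[OF x, of i j l] by (simp add: nabla2_T_C[OF x])
  note * = recurrence_algebra[OF dim GH[OF x], of "\<lambda>i j. T i j x" "\<lambda>i. A x $ i" a "\<lambda>i. C i x",
      OF G_commute[OF x] T_commute[OF x] A_nonzero[OF x] eq]
  show "C i x = - \<tau> x * A x $ i" using *(1)[of i] by (simp add: \<tau>_eq[OF x])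
  show "Q i j x = Q a a x / (A x $ a * A x $ a) * (A x $ i * A x $ j)"
    using *(2)[of i j] by (simp add: \<tau>_eq[OF x] Q_def)
qed

lemma B_eq: "x \<in> S \<Longrightarrow> B x $ i = - (2 * (real CARD('n) - 1) * \<tau> x) * A x $ i"
  by (simp add: B_C C_eq)

lemma \<tau>_nonzero: "x \<in> S \<Longrightarrow> \<tau> x \<noteq> 0"
  using B_nonzero[of x] B_eq[of x] by (auto simp: vec_eq_iff)

lemma pderivative_trace_T: "x \<in> S \<Longrightarrow> pderivative k trace_T x = A x $ k * (trace_T x - real CARD('n) * \<tau> x)"
  by (simp add: pderivative_trace_T_C C_eq algebra_simps)

lemma nabla2_Q:
  assumes x: "x \<in> S"
  shows "nabla2 Q i j k x = A x $ i * Q j k x - pderivative i \<tau> x * G x $ j $ k"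
proof -
  have sm: "smooth_on S (\<lambda>y. \<tau> y * G y $ j $ k)" for j k
    by (intro smooth_on_mult smooth_\<tau> smooth_G open_S)
  show ?thesis unfolding Q_def
    by (subst nabla2_diff[OF x smooth_T sm], subst nabla2_scaled_metric[OF x smooth_\<tau>])
      (simp add: nabla2_T_C[OF x] C_eq[OF x] algebra_simps)
qed

text \<open>Where \<open>Q\<close> has rank one, differentiating its vanishing minors forces \<open>\<tau>\<close> to be stationary.\<close>

lemma pderivative_\<tau>_zero_if_Q:
  assumes x: "x \<in> S" and Q: "Q a a x \<noteq> 0"
  shows "pderivative i \<tau> x = 0"
proof -
  define \<mu> where "\<mu> = Q a a x / (A x $ a * A x $ a)"
  have \<mu>: "\<mu> \<noteq> 0" using Q A_nonzero[OF x] by (simp add: \<mu>_def)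
  have Qx: "Q j k x = \<mu> * A x $ j * A x $ k" for j k using Q_eq[OF x, of j k] by (simp add: \<mu>_def)
  define w where "w j = (\<Sum>m\<in>UNIV. \<Gamma> x m i j * A x $ m)" for j
  have DQ: "pderivative i (Q j k) x = \<mu> * (A x $ i * A x $ j * A x $ k + w j * A x $ k + A x $ j * w k)
      - pderivative i \<tau> x * G x $ j $ k" for j k
    using nabla2_Q[OF x, of i j k]
    by (simp add: nabla2_def Qx w_def sum_distrib_left sum_distrib_right algebra_simps)
  \<comment> \<open>The \<open>2 \<times> 2\<close> minors of \<open>Q\<close> vanish identically on
    \<open>S\<close> by \<open>Q_eq\<close>. In their derivative the terms of \<open>DQ\<close>
    tangent to the rank-one matrices drop out, and only the term with the derivative of \<tau>
    survives.\<close>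
  have minor: "pderivative i \<tau> x * \<mu> * (G x $ b $ c * (A x $ a * A x $ a) + A x $ b * A x $ c * G x $ a $ a
     - A x $ a * A x $ c * G x $ b $ a - A x $ a * A x $ b * G x $ a $ c) = 0" for b c
  proof -
    have "0 = pderivative i (\<lambda>y. Q b c y * Q a a y - Q b a y * Q a c y) x"
    proof (subst pderivative_cong[OF open_S x, of _ "\<lambda>y. 0"])
      show "Q b c y * Q a a y - Q b a y * Q a c y = 0" if "y \<in> S" for y
        by (simp add: Q_eq[OF that, of b c] Q_eq[OF that, of b a] Q_eq[OF that, of a c])
    qed simp
    also have "\<dots> = Q b c x * pderivative i (Q a a) x + pderivative i (Q b c) x * Q a a x
      - (Q b a x * pderivative i (Q a c) x + pderivative i (Q b a) x * Q a c x)"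
      using x smooth_Q open_S by (simp add: pderivative_smooth smooth_on_mult)
    finally show ?thesis unfolding DQ Qx by (simp add: algebra_simps)
  qed
  obtain b c where "G x $ b $ c * (A x $ a * A x $ a) + A x $ b * A x $ c * G x $ a $ a
     - A x $ a * A x $ c * G x $ b $ a - A x $ a * A x $ b * G x $ a $ c \<noteq> 0"
    using hyperplane_form_nonzero[OF dim GH[OF x], of "\<lambda>i. A x $ i" a] A_nonzero[OF x] by blast
  then show ?thesis using minor[of b c] \<mu> by simp
qed

text \<open>On the open set where \<open>Q\<close> does not vanish, \<open>\<omega>\<close> is a recurrent 1-form; the Ricci identity for it
  computes the trace of \<open>T\<close>.\<close>

definition \<omega> :: "'n \<Rightarrow> real^'n \<Rightarrow> real" where
  "\<omega> i x = A x $ i / A x $ a"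

text \<open>The only candidate for the recurrence form of \<omega>: it is the covariant derivative
  of the component \<omega>\<open>\<^sub>a\<close>, which is constantly 1.\<close>

definition \<theta> :: "'n \<Rightarrow> real^'n \<Rightarrow> real" where
  "\<theta> i x = - (\<Sum>m\<in>UNIV. \<Gamma> x m i a * \<omega> m x)"

lemma smooth_\<omega>: "smooth_on S (\<omega> i)"
  unfolding \<omega>_def by (intro smooth_on_divide smooth_A A_nonzero open_S)

lemma smooth_\<theta>: "smooth_on S (\<theta> i)"
  unfolding \<theta>_def by (intro smooth_on_uminus smooth_on_sum smooth_on_mult smooth_\<Gamma> smooth_\<omega> open_S)

lemma \<omega>_a: "x \<in> S \<Longrightarrow> \<omega> a x = 1"
  using A_nonzero by (simp add: \<omega>_def)

lemma Q_\<omega>: "x \<in> S \<Longrightarrow> Q i j x = Q a a x * \<omega> i x * \<omega> j x"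
  using Q_eq[of x i j] by (simp add: \<omega>_def)

text \<open>Where \<tau> is stationary, \<open>Q\<close> satisfies
  \<open>\<nabla>Q = A \<otimes> Q\<close>. Expanding the derivative of row \<open>a\<close> of
  \<open>Q = Q a a * \<omega> \<otimes> \<omega>\<close> and cancelling the nonzero
  \<open>Q a a\<close> leaves the derivative of \<omega>.\<close>

lemma nabla_\<omega>:
  assumes x: "x \<in> S" and Q: "Q a a x \<noteq> 0"
  shows "nabla \<omega> i j x = \<theta> i x * \<omega> j x"
proof -
  define c where "c = Q a a x"
  define w where "w j = (\<Sum>m\<in>UNIV. \<Gamma> x m i j * \<omega> m x)" for j
  have Qx: "Q j k x = c * \<omega> j x * \<omega> k x" for j k using Q_\<omega>[OF x, of j k] by (simp add: c_def)
  have DQ: "pderivative i (Q a k) x = c * (A x $ i * \<omega> k x + w a * \<omega> k x + w k)" for k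
    using nabla2_Q[OF x, of i a k] pderivative_\<tau>_zero_if_Q[OF x Q, of i]
    by (simp add: nabla2_def Qx \<omega>_a[OF x] w_def sum_distrib_left sum_distrib_right algebra_simps)
  have "pderivative i (Q a j) x = pderivative i (\<lambda>y. \<omega> j y * Q a a y) x"
    by (rule pderivative_cong[OF open_S x]) (simp add: Q_\<omega>[of _ a j] \<omega>_a)
  also have "\<dots> = \<omega> j x * pderivative i (Q a a) x + pderivative i (\<omega> j) x * c"
    using x smooth_\<omega> smooth_Q by (simp add: pderivative_smooth c_def)
  finally have "c * (pderivative i (\<omega> j) x - w j) = c * (- w a * \<omega> j x)"
    unfolding DQ \<omega>_a[OF x] by (simp add: algebra_simps)
  then have "pderivative i (\<omega> j) x - w j = - w a * \<omega> j x"
    using Q by (simp only: mult_cancel_left c_def simp_thms)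
  then show ?thesis by (simp add: nabla_def \<theta>_def w_def)
qed

text \<open>Allows identities valid only where \<open>Q a a\<close> is nonzero to be
  differentiated.\<close>

lemma open_Q: "open {x \<in> S. Q a a x \<noteq> 0}"
proof -
  have "open (S \<inter> Q a a -` (- {0}))"
    by (intro continuous_open_preimage smooth_on_continuous[OF smooth_Q] open_S open_Compl) simp
  also have "S \<inter> Q a a -` (- {0}) = {x \<in> S. Q a a x \<noteq> 0}" by auto
  finally show ?thesis .
qed

lemma trace_T_if_Q:
  assumes x: "x \<in> S" and Q: "Q a a x \<noteq> 0"
  shows "trace_T x = (real CARD('n) - 2) * \<tau> x"
proof -
  have xQ: "x \<in> {x \<in> S. Q a a x \<noteq> 0}" using x Q by simp
  \<comment> \<open>The claim is \<kappa> = 0. By \<open>trace\<close> below, \<kappa> also equals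
    \<open>2 * \<tau> x + c * \<nu>\<close>, with \<nu> the squared length of \<omega>, and this is
    the factor arising from the curvature.\<close>
  define \<kappa> where "\<kappa> = 2 * \<tau> x + trace_T x - real CARD('n) * \<tau> x"
  define c where "c = Q a a x"
  have T: "T i j x = \<tau> x * G x $ i $ j + c * \<omega> i x * \<omega> j x" for i j
    using Q_\<omega>[OF x, of i j] by (simp add: Q_def c_def)
  define \<nu> where "\<nu> = (\<Sum>b\<in>UNIV. \<omega> b x * (\<Sum>l\<in>UNIV. H x $ b $ l * \<omega> l x))"
  have trace: "trace_T x = real CARD('n) * \<tau> x + c * \<nu>"
  proof -
    have "trace_T x = \<tau> x * (\<Sum>i\<in>UNIV. \<Sum>b\<in>UNIV. H x $ i $ b * G x $ i $ b) + c * \<nu>"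
      unfolding H_T[OF x, symmetric] \<nu>_def T
      by (simp add: algebra_simps sum.distrib sum_distrib_left)
    then show ?thesis by (simp add: H_G[OF x])
  qed
  have X: "(\<Sum>l\<in>UNIV. T_mixed i l x * \<omega> l x) = (\<tau> x + c * \<nu>) * \<omega> i x" for i
  proof -
    have "(\<Sum>l\<in>UNIV. T_mixed i l x * \<omega> l x) = (\<Sum>b\<in>UNIV. T i b x * (\<Sum>l\<in>UNIV. H x $ b $ l * \<omega> l x))"
      by (simp add: sum_sum_mult_swap T_mixed_eq[OF x] H_commute[OF x])
    also have "\<dots> = \<tau> x * (\<Sum>b\<in>UNIV. G x $ i $ b * (\<Sum>l\<in>UNIV. H x $ b $ l * \<omega> l x)) + c * \<omega> i x * \<nu>"
      unfolding T \<nu>_def by (simp add: algebra_simps sum.distrib sum_distrib_left)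
    finally show ?thesis unfolding lower_raise[OF x] by (simp add: algebra_simps)
  qed
  have n2: "nabla2 (nabla \<omega>) i j k x = \<theta> j x * (\<theta> i x * \<omega> k x) + nabla \<theta> i j x * \<omega> k x" for i j k
  proof -
    have "nabla2 (nabla \<omega>) i j k x = nabla2 (\<lambda>j k y. \<theta> j y * \<omega> k y) i j k x"
      by (rule nabla2_cong[OF open_Q xQ]) (simp add: nabla_\<omega>)
    then show ?thesis by (simp add: nabla2_mult[of x \<theta> \<omega>, OF x smooth_\<theta> smooth_\<omega>] nabla_\<omega>[OF x Q])
  qed
  have eq: "(nabla \<theta> i j x - nabla \<theta> j i x) * \<omega> k x = - (\<kappa> * (\<omega> i x * G x $ j $ k - \<omega> j x * G x $ i $ k))" for i j k
    using ricci_identity[of x \<omega>, OF x smooth_\<omega>, of i j k]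
    unfolding n2 riemann_contract[OF x] X T \<kappa>_def trace by (simp add: algebra_simps)
  have "\<kappa> * (G x $ b $ d * (\<omega> a x * \<omega> a x) + \<omega> b x * \<omega> d x * G x $ a $ a
     - \<omega> a x * \<omega> d x * G x $ b $ a - \<omega> a x * \<omega> b x * G x $ a $ d) = 0" for b d
  proof -
    \<comment> \<open>Taking \<open>k = a\<close>, where \<omega> is 1, solves for the exterior
      derivative of \<theta>; substituting it back leaves \<kappa> times the nonzero form of
      \<open>hyperplane_form_nonzero\<close>.\<close>
    have F: "nabla \<theta> a b x - nabla \<theta> b a x = - (\<kappa> * (G x $ b $ a - \<omega> b x * G x $ a $ a))"
      using eq[of a b a] by (simp add: \<omega>_a[OF x])
    show ?thesis using eq[of a b d] unfolding F by (simp add: \<omega>_a[OF x] algebra_simps)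
  qed
  moreover obtain b d where "G x $ b $ d * (\<omega> a x * \<omega> a x) + \<omega> b x * \<omega> d x * G x $ a $ a
     - \<omega> a x * \<omega> d x * G x $ b $ a - \<omega> a x * \<omega> b x * G x $ a $ d \<noteq> 0"
    using hyperplane_form_nonzero[OF dim GH[OF x], of "\<lambda>i. \<omega> i x" a] \<omega>_a[OF x] by auto
  ultimately have "\<kappa> = 0" by (metis mult_eq_0_iff)
  then show ?thesis by (simp add: \<kappa>_def algebra_simps)
qed

lemma Q_zero:
  assumes x: "x \<in> S"
  shows "Q i j x = 0"
proof -
  have "Q a a x = 0"
  proof (rule ccontr)
    assume Q: "Q a a x \<noteq> 0"
    have xQ: "x \<in> {x \<in> S. Q a a x \<noteq> 0}" using x Q by simp
    \<comment> \<open>Near \<open>x\<close> the trace is a constant multiple of \<tau>, which is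
      stationary at \<open>x\<close>; the traced recurrence instead gives the nonzero derivative
      \<open>- 2 * \<tau> x * A x $ a\<close>.\<close>
    have "pderivative a trace_T x = pderivative a (\<lambda>y. (real CARD('n) - 2) * \<tau> y) x"
      by (rule pderivative_cong[OF open_Q xQ]) (simp add: trace_T_if_Q)
    also have "\<dots> = 0"
      using x smooth_\<tau> smooth_on_const[of S "real CARD('n) - 2"] pderivative_\<tau>_zero_if_Q[OF x Q]
      by (simp add: pderivative_smooth)
    finally have "A x $ a * (- 2 * \<tau> x) = 0"
      unfolding pderivative_trace_T[OF x] trace_T_if_Q[OF x Q] by (simp add: algebra_simps)
    then show False using A_nonzero[OF x] \<tau>_nonzero[OF x] by simp
  qed
  then show ?thesis using Q_eq[OF x, of i j] by simp
qed

section \<open>Curvature of the chart once the rank-one part is gone\<close>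

lemma T_eq: "x \<in> S \<Longrightarrow> T i j x = \<tau> x * G x $ i $ j"
  using Q_zero[of x i j] by (simp add: Q_def)

text \<open>With \<open>Q\<close> identically zero, \<open>nabla2_Q\<close> reduces to the
  derivative of \<tau> times the metric, which is nondegenerate.\<close>

lemma pderivative_\<tau>:
  assumes x: "x \<in> S"
  shows "pderivative i \<tau> x = 0"
proof (rule degenerate_form_zero[OF GH[OF x]])
  fix j k
  have "nabla2 Q i j k x = nabla2 (\<lambda>j k y. 0) i j k x"
    by (rule nabla2_cong[OF open_S x Q_zero])
  then show "pderivative i \<tau> x * G x $ j $ k = 0"
    using nabla2_Q[OF x, of i j k] by (simp add: nabla2_def Q_zero[OF x])
qed

lemma T_mixed_kronecker: "x \<in> S \<Longrightarrow> T_mixed i l x = \<tau> x * kronecker l i"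
  using HG[of x l i, THEN arg_cong, of "\<lambda>t. \<tau> x * t"]
  by (simp add: T_mixed_eq T_eq G_commute[of x i] sum_distrib_left mult_ac)

lemma ricci_\<tau>: "x \<in> S \<Longrightarrow> ricci G x $ j $ k = 2 * (real CARD('n) - 1) * \<tau> x * G x $ j $ k"
  by (simp add: ricci_eq T_eq trace_T_def T_mixed_kronecker algebra_simps)

lemma riemann_\<tau>:
  "x \<in> S \<Longrightarrow> riemann G x l k i j = 2 * \<tau> x * (kronecker l i * G x $ j $ k - kronecker l j * G x $ i $ k)"
  by (simp add: riemann_eq T_eq T_mixed_kronecker algebra_simps)

end

section \<open>Constant curvature\<close>

text \<open>The hypothesis gives \<open>R(u,v)v = K (g(v,v) u - g(u,v) v)\<close>; pairing with
  \<open>u\<close> produces \<open>K\<close> times the denominator of the sectional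
  curvature.\<close>

lemma sectional_curvature_constant:
  fixes G :: "real^'n::finite \<Rightarrow> real^'n^'n"
  assumes sym: "transpose (G x) = G x"
    and R: "\<And>l k i j. riemann G x l k i j = K * (kronecker l i * G x $ j $ k - kronecker l j * G x $ i $ k)"
    and nondeg: "nondegenerate_plane G x u v"
  shows "sectional_curvature G x u v = K"
proof -
  have inner: "w \<bullet> (G x *v v) = (\<Sum>j\<in>UNIV. w $ j * (G x *v v) $ j)" for w
    by (simp add: inner_vec_def)
  have "riemann_op G x u v v $ l = (K *\<^sub>R ((v \<bullet> (G x *v v)) *\<^sub>R u - (u \<bullet> (G x *v v)) *\<^sub>R v)) $ l" for l
  proof -
    have "riemann_op G x u v v $ l
      = (\<Sum>i\<in>UNIV. \<Sum>j\<in>UNIV. K * (kronecker l i * (u $ i * (v $ j * (G x *v v) $ j)) - kronecker l j * (v $ j * (u $ i * (G x *v v) $ i))))"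
      by (simp add: riemann_op_def R matrix_vector_mult_def algebra_simps sum.distrib sum_subtractf sum_distrib_left)
    also have "\<dots> = (\<Sum>i\<in>UNIV. K * (kronecker l i * (u $ i * (v \<bullet> (G x *v v))) - v $ l * (u $ i * (G x *v v) $ i)))"
    proof (rule sum.cong)
      fix i
      have "(\<Sum>j\<in>UNIV. kronecker l j * (v $ j * (u $ i * (G x *v v) $ i))) = v $ l * (u $ i * (G x *v v) $ i)"
        by (rule sum_kronecker)
      then show "(\<Sum>j\<in>UNIV. K * (kronecker l i * (u $ i * (v $ j * (G x *v v) $ j)) - kronecker l j * (v $ j * (u $ i * (G x *v v) $ i))))
        = K * (kronecker l i * (u $ i * (v \<bullet> (G x *v v))) - v $ l * (u $ i * (G x *v v) $ i))"
        unfolding inner by (simp only: sum_distrib_left[symmetric] sum_subtractf)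
    qed simp
    also have "\<dots> = K * (u $ l * (v \<bullet> (G x *v v)) - v $ l * (u \<bullet> (G x *v v)))"
    proof -
      have "(\<Sum>i\<in>UNIV. kronecker l i * (u $ i * (v \<bullet> (G x *v v)))) = u $ l * (v \<bullet> (G x *v v))"
        by (rule sum_kronecker)
      then show ?thesis
        unfolding inner[of u] by (simp only: sum_distrib_left[symmetric] sum_subtractf)
    qed
    finally show ?thesis by (simp add: mult.commute)
  qed
  then have op: "riemann_op G x u v v = K *\<^sub>R ((v \<bullet> (G x *v v)) *\<^sub>R u - (u \<bullet> (G x *v v)) *\<^sub>R v)"
    unfolding vec_eq_iff by (rule allI)
  have "v \<bullet> (G x *v u) = u \<bullet> (G x *v v)"
    using dot_lmul_matrix[of v "G x" u] sym by (simp add: inner_commute vector_transpose_matrix[symmetric])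
  then have "metric_form G x (riemann_op G x u v v) u
      = K * (metric_form G x u u * metric_form G x v v - (metric_form G x u v)\<^sup>2)"
    unfolding op metric_form_def by (simp add: inner_diff_left power2_eq_square algebra_simps)
  then show ?thesis
    using nondeg by (simp add: sectional_curvature_def nondegenerate_plane_def)
qed

section \<open>From charts to the manifold\<close>

lemma chart_inv_coords:
  assumes c: "is_chart X c" and p: "p \<in> chart_dom c"
  shows "chart_inv c (coords c p) = p"
proof -
  have "inj_on (coords c) (topspace (subtopology X (chart_dom c)))"
    using c by (simp add: is_chart_def homeomorphic_eq_everything_map)
  moreover have "topspace (subtopology X (chart_dom c)) = chart_dom c"
    using c openin_subset[of X "chart_dom c"] by (auto simp: is_chart_def)
  ultimately show ?thesis using p by (simp add: chart_inv_def)
qed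

lemma open_chart_image:
  assumes c: "is_chart X c" and U: "openin X U"
  shows "open (coords c ` (U \<inter> chart_dom c))"
proof -
  have "openin (subtopology X (chart_dom c)) (U \<inter> chart_dom c)"
    using U by (auto simp: openin_subtopology)
  moreover have "open_map (subtopology X (chart_dom c)) (top_of_set (coords c ` chart_dom c)) (coords c)"
    using c by (simp add: is_chart_def homeomorphic_eq_everything_map)
  ultimately have "openin (top_of_set (coords c ` chart_dom c)) (coords c ` (U \<inter> chart_dom c))"
    by (simp add: open_map_def)
  then show ?thesis using c by (auto simp: is_chart_def openin_open_eq)
qed

lemma open_chart_preimage:
  assumes c: "is_chart X c" and V: "open V"
  shows "openin X {p \<in> chart_dom c. coords c p \<in> V}"
proof -
  have "continuous_map (subtopology X (chart_dom c)) (top_of_set (coords c ` chart_dom c)) (coords c)"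
    using c by (simp add: is_chart_def homeomorphic_eq_everything_map)
  then have "continuous_map (subtopology X (chart_dom c)) euclidean (coords c)"
    using continuous_map_into_fulltopology by blast
  then have "openin (subtopology X (chart_dom c)) {p \<in> topspace (subtopology X (chart_dom c)). coords c p \<in> V}"
    using V by (intro openin_continuous_map_preimage) auto
  moreover have top: "topspace (subtopology X (chart_dom c)) = chart_dom c" and dom: "openin X (chart_dom c)"
    using c openin_subset[of X "chart_dom c"] by (auto simp: is_chart_def)
  ultimately have "openin (subtopology X (chart_dom c)) {p \<in> chart_dom c. coords c p \<in> V}"
    by (simp only: top)
  then show ?thesis by (rule openin_trans_full[OF _ dom])
qed

lemma constant_if_pderivatives_zero:
  fixes f :: "real^'n::finite \<Rightarrow> real"
  assumes "convex S" "\<And>x. x \<in> S \<Longrightarrow> f differentiable (at x)"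
    and "\<And>x i. x \<in> S \<Longrightarrow> pderivative i f x = 0"
  obtains c where "\<And>x. x \<in> S \<Longrightarrow> f x = c"
proof -
  have "(f has_derivative (\<lambda>h. 0)) (at x within S)" if "x \<in> S" for x
  proof -
    have "frechet_derivative f (at x) = (\<lambda>h. 0)"
      using assms(2,3)[OF that] by (simp add: fun_eq_iff frechet_derivative_pderivatives)
    then show ?thesis
      using has_derivative_frechet[OF assms(2)[OF that]] by (simp add: has_derivative_at_withinI)
  qed
  then show ?thesis using has_derivative_zero_constant[OF assms(1)] that by metis
qed

text \<open>Shrink to a coordinate ball on which the metric is conformal to a flat one and a fixed
  component of \<open>A\<close> has no zeros, and apply \<open>recurrent_chart\<close>. The ball is
  convex, so the stationary function \<tau> is a constant \<open>t\<close> there.\<close>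

lemma locally_constant_curvature:
  fixes X :: "'a topology" and \<A> :: "('a, 'n::finite) chart set" and g :: "('a, 'n) tensor2_field"
    and A B :: "('a, 'n) covector_field"
  assumes dim: "CARD('n) \<ge> 3"
    and manifold: "pseudo_riemannian_manifold X \<A> q g"
    and conf: "conformally_flat X \<A> g"
    and A: "one_form \<A> A" "nowhere_vanishing \<A> A"
    and B: "one_form \<A> B" "nowhere_vanishing \<A> B"
    and rec: "\<And>c p i j l. c \<in> \<A> \<Longrightarrow> p \<in> chart_dom c \<Longrightarrow>
           covariant_derivative (christoffel (g c) (coords c p)) (ricci (g c)) (coords c p) i j l
             = A c (coords c p) $ i * ricci (g c) (coords c p) $ j $ l
               + B c (coords c p) $ i * g c (coords c p) $ j $ l"
    and c: "c \<in> \<A>" and p: "p \<in> chart_dom c"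
  obtains W t where "openin X W" "p \<in> W" "W \<subseteq> chart_dom c" "t \<noteq> 0"
    "\<And>r. r \<in> W \<Longrightarrow> B c (coords c r) = (- (2 * (real CARD('n) - 1) * t)) *\<^sub>R A c (coords c r)"
    "\<And>r j k. r \<in> W \<Longrightarrow> ricci (g c) (coords c r) $ j $ k = 2 * (real CARD('n) - 1) * t * g c (coords c r) $ j $ k"
    "\<And>r l k i j. r \<in> W \<Longrightarrow> riemann (g c) (coords c r) l k i j
       = 2 * t * (kronecker l i * g c (coords c r) $ j $ k - kronecker l j * g c (coords c r) $ i $ k)"
proof -
  have chart: "is_chart X c" and "p \<in> topspace X"
    using manifold c p unfolding pseudo_riemannian_manifold_def smooth_manifold_def smooth_atlas_def by auto
  then obtain U h \<sigma> where U: "openin X U" "p \<in> U" and \<sigma>: "smooth_function_on \<A> U \<sigma>"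
    and h: "\<And>r. r \<in> U \<inter> chart_dom c \<Longrightarrow> h c (coords c r) = exp (2 * \<sigma> r) *\<^sub>R g c (coords c r)"
    and flat: "\<And>r l k i j. r \<in> U \<inter> chart_dom c \<Longrightarrow> riemann (h c) (coords c r) l k i j = 0"
    using conf c unfolding conformally_flat_def conformal_on_def flat_on_def by metis
  let ?S = "coords c ` (U \<inter> chart_dom c)"
  have openS: "open ?S" by (rule open_chart_image[OF chart U(1)])
  obtain a where a: "A c (coords c p) $ a \<noteq> 0"
    using A(2) c p unfolding nowhere_vanishing_def by (metis vec_eq_iff zero_index)
  have smooth_A: "smooth_on ?S (\<lambda>x. A c x $ i)" for i
    using A(1) c unfolding one_form_def by (auto intro: smooth_on_subset)
  have "open (?S \<inter> (\<lambda>x. A c x $ a) -` (- {0}))"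
    by (intro continuous_open_preimage smooth_on_continuous[OF smooth_A] openS open_Compl) simp
  then obtain e where e: "e > 0" "ball (coords c p) e \<subseteq> ?S \<inter> (\<lambda>x. A c x $ a) -` (- {0})"
    using U(2) p a open_contains_ball by (metis (no_types, lifting) ComplI IntI image_eqI singletonD vimageI)
  let ?D = "ball (coords c p) e"
  have DS: "?D \<subseteq> coords c ` chart_dom c" using e by blast
  interpret recurrent_chart ?D "g c" "\<lambda>x. \<sigma> (chart_inv c x)" "A c" "B c" a
  proof
    have g: "pseudo_riemannian_metric \<A> q g" using manifold by (simp add: pseudo_riemannian_manifold_def)
    show "smooth_on ?D (\<lambda>x. g c x $ i $ j)" for i j
      using g c DS unfolding pseudo_riemannian_metric_def smooth_tensor2_def by (blast intro: smooth_on_subset)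
    show "transpose (g c x) = g c x" "invertible (g c x)" if "x \<in> ?D" for x
      using g c DS that unfolding pseudo_riemannian_metric_def by blast+
    show "smooth_on ?D (\<lambda>x. \<sigma> (chart_inv c x))"
      using \<sigma> c e(2) unfolding smooth_function_on_def by (blast intro: smooth_on_subset)
    show "riemann (\<lambda>y. exp (2 * \<sigma> (chart_inv c y)) *\<^sub>R g c y) x l k i j = 0" if x: "x \<in> ?D" for x l k i j
    proof -
      \<comment> \<open>The flat metric \<open>h\<close> is tied to \<open>g\<close> only over
        \<open>U\<close>; agreement on the open ball suffices to transfer its curvature.\<close>
      have "exp (2 * \<sigma> (chart_inv c y)) *\<^sub>R g c y = h c y" if "y \<in> ?D" for y
        using that e(2) h chart_inv_coords[OF chart] by auto
      then have "riemann (\<lambda>y. exp (2 * \<sigma> (chart_inv c y)) *\<^sub>R g c y) x l k i j = riemann (h c) x l k i j"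
        using x by (intro riemann_cong[of ?D]) auto
      then show ?thesis using x e(2) flat by auto
    qed
    show "smooth_on ?D (\<lambda>x. A c x $ i)" for i using smooth_A e(2) by (blast intro: smooth_on_subset)
    show "smooth_on ?D (\<lambda>x. B c x $ i)" for i
      using B(1) c DS unfolding one_form_def by (blast intro: smooth_on_subset)
    show "A c x $ a \<noteq> 0" if "x \<in> ?D" for x using that e(2) by blast
    show "B c x \<noteq> 0" if "x \<in> ?D" for x
      using that DS B(2) c unfolding nowhere_vanishing_def by blast
    show "covariant_derivative (christoffel (g c) x) (ricci (g c)) x i j l
        = A c x $ i * ricci (g c) x $ j $ l + B c x $ i * g c x $ j $ l" if "x \<in> ?D" for x i j l
      using that DS rec[OF c] by blast
  qed (use dim in auto)
  obtain t where t: "\<And>x. x \<in> ?D \<Longrightarrow> \<tau> x = t"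
    using constant_if_pderivatives_zero[of ?D \<tau>] smooth_on_differentiable[OF smooth_\<tau>] pderivative_\<tau>
      convex_ball by metis
  show ?thesis
  proof (rule that[of "{r \<in> chart_dom c. coords c r \<in> ?D}" t])
    show "openin X {r \<in> chart_dom c. coords c r \<in> ?D}" by (rule open_chart_preimage[OF chart open_ball])
    show "p \<in> {r \<in> chart_dom c. coords c r \<in> ?D}" using p e(1) by simp
    show "t \<noteq> 0" using t[of "coords c p"] \<tau>_nonzero[of "coords c p"] e(1) by simp
    fix r assume r: "r \<in> {r \<in> chart_dom c. coords c r \<in> ?D}"
    then have rD: "coords c r \<in> ?D" by simp
    show "B c (coords c r) = (- (2 * (real CARD('n) - 1) * t)) *\<^sub>R A c (coords c r)"
      using B_eq[OF rD] t[OF rD] by (simp add: vec_eq_iff)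
    show "ricci (g c) (coords c r) $ j $ k = 2 * (real CARD('n) - 1) * t * g c (coords c r) $ j $ k" for j k
      using ricci_\<tau>[OF rD] t[OF rD] by simp
    show "riemann (g c) (coords c r) l k i j
       = 2 * t * (kronecker l i * g c (coords c r) $ j $ k - kronecker l j * g c (coords c r) $ i $ k)" for l k i j
      using riemann_\<tau>[OF rD] t[OF rD] by simp
  qed auto
qed

theorem theorem1p1:
  fixes X :: "'a topology"
    and \<A> :: "('a, 'n::finite) chart set"
    and q :: nat
    and g :: "('a, 'n) tensor2_field"
  assumes "CARD('n) \<ge> 3"
    and "q \<le> CARD('n)"
    and "pseudo_riemannian_manifold X \<A> q g"
    and "connected_space X"
    and "conformally_flat X \<A> g"
    and "generalized_ricci_recurrent X \<A> g"
  shows "einstein \<A> g \<and> (de_sitter X \<A> q g \<or> anti_de_sitter X \<A> q g)"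
proof -

  \<comment> \<open>Globalising the local constant\<close>
  let ?m = "2 * (real CARD('n) - 1)"
  have atlas: "smooth_atlas X \<A>"
    using assms(3) by (simp add: pseudo_riemannian_manifold_def smooth_manifold_def)
  then have charts: "(\<Union>c\<in>\<A>. chart_dom c) = topspace X" by (simp add: smooth_atlas_def)
  obtain A B where A: "one_form \<A> A" "nowhere_vanishing \<A> A"
    and B: "one_form \<A> B" "nowhere_vanishing \<A> B"
    and rec: "\<And>c p i j l. c \<in> \<A> \<Longrightarrow> p \<in> chart_dom c \<Longrightarrow>
           covariant_derivative (christoffel (g c) (coords c p)) (ricci (g c)) (coords c p) i j l
             = A c (coords c p) $ i * ricci (g c) (coords c p) $ j $ l
               + B c (coords c p) $ i * g c (coords c p) $ j $ l"
    using assms(6) unfolding generalized_ricci_recurrent_def by blast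
  note local = locally_constant_curvature[OF assms(1,3,5) A B rec]
  \<comment> \<open>The proportionality of \<open>B\<close> and \<open>A\<close> is tensorial,
    unlike the chart-dependent quotient defining \<tau>, so its level sets can be compared across
    charts.\<close>
  define E where "E t = {p \<in> topspace X. \<exists>c\<in>\<A>. p \<in> chart_dom c \<and> B c (coords c p) = (- (?m * t)) *\<^sub>R A c (coords c p)}" for t
  have transfer: "B d (coords d p) = k *\<^sub>R A d (coords d p)"
    if "c \<in> \<A>" "d \<in> \<A>" "p \<in> chart_dom c \<inter> chart_dom d" "B c (coords c p) = k *\<^sub>R A c (coords c p)" for c d p k
  proof -
    have "A d (coords d p) = transpose (transition_matrix d c p) *v A c (coords c p)"
      "B d (coords d p) = transpose (transition_matrix d c p) *v B c (coords c p)"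
      using A(1) B(1) that(1-3) unfolding one_form_def by blast+
    then show ?thesis by (simp only: that(4) matrix_vector_mult_scaleR)
  qed
  have E_iff: "p \<in> E t \<longleftrightarrow> B c (coords c p) = (- (?m * t)) *\<^sub>R A c (coords c p)"
    if "c \<in> \<A>" "p \<in> chart_dom c" for p t c
  proof
    assume "p \<in> E t"
    then obtain d where "d \<in> \<A>" "p \<in> chart_dom d" "B d (coords d p) = (- (?m * t)) *\<^sub>R A d (coords d p)"
      unfolding E_def by blast
    then show "B c (coords c p) = (- (?m * t)) *\<^sub>R A c (coords c p)" using transfer[of d c p] that by blast
  next
    assume "B c (coords c p) = (- (?m * t)) *\<^sub>R A c (coords c p)"
    then show "p \<in> E t" using that charts unfolding E_def by auto
  qed
  have unique: "t = t'" if E: "p \<in> E t" "p \<in> E t'" for p t t'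
  proof -
    obtain c where c: "c \<in> \<A>" "p \<in> chart_dom c" using E(1) unfolding E_def by blast
    have "A c (coords c p) \<noteq> 0" using A(2) c by (simp add: nowhere_vanishing_def)
    moreover have "(- (?m * t)) *\<^sub>R A c (coords c p) = (- (?m * t')) *\<^sub>R A c (coords c p)"
      using E E_iff[OF c] by metis
    ultimately show ?thesis using assms(1) by simp
  qed
  have openE: "openin X (E t)" for t
  proof (subst openin_subopen, intro ballI)
    fix p assume p: "p \<in> E t"
    then obtain c where c: "c \<in> \<A>" "p \<in> chart_dom c" unfolding E_def by blast
    obtain W t' where W: "openin X W" "p \<in> W" "W \<subseteq> chart_dom c"
      "\<And>r. r \<in> W \<Longrightarrow> B c (coords c r) = (- (?m * t')) *\<^sub>R A c (coords c r)"
      using local[OF _ _ c] by metis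
    have "r \<in> E t'" if "r \<in> W" for r using E_iff[OF c(1)] W that by blast
    moreover from this have "t' = t" using unique[OF _ p] W(2) by blast
    ultimately show "\<exists>V. openin X V \<and> p \<in> V \<and> V \<subseteq> E t" using W by blast
  qed
  have cover: "\<exists>t. p \<in> E t" if "p \<in> topspace X" for p
  proof -
    obtain c where c: "c \<in> \<A>" "p \<in> chart_dom c" using charts \<open>p \<in> topspace X\<close> by blast
    show ?thesis using local[OF _ _ c] E_iff[OF c] by metis
  qed
  \<comment> \<open>Non-flatness excludes the empty manifold.\<close>
  obtain p0 where "p0 \<in> topspace X"
    using assms(6) unfolding generalized_ricci_recurrent_def flat_on_def by blast
  then obtain t where t: "p0 \<in> E t" using cover by blast
  \<comment> \<open>The open level sets partition the space, so each is also closed; connectedness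
    leaves only one nonempty level set.\<close>
  have "topspace X - E t = (\<Union>t'\<in>- {t}. E t')"
  proof (intro set_eqI iffI)
    fix p assume p: "p \<in> topspace X - E t"
    then obtain t' where "p \<in> E t'" using cover by blast
    then show "p \<in> (\<Union>t'\<in>- {t}. E t')" using p by blast
  next
    fix p assume "p \<in> (\<Union>t'\<in>- {t}. E t')"
    then obtain t' where "t' \<noteq> t" "p \<in> E t'" by blast
    moreover from this have "p \<in> topspace X" by (simp add: E_def)
    ultimately show "p \<in> topspace X - E t" using unique by blast
  qed
  then have "openin X (topspace X - E t)" using openE by auto
  then have "closedin X (E t)" using openE openin_subset by (auto simp: closedin_def)
  then have Et: "E t = topspace X"
    using assms(4) openE t unfolding connected_space_clopen_in by blast
  have main: "t \<noteq> 0 \<and> (\<forall>j k. ricci (g c) (coords c p) $ j $ k = ?m * t * g c (coords c p) $ j $ k)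
     \<and> (\<forall>l k i j. riemann (g c) (coords c p) l k i j
       = 2 * t * (kronecker l i * g c (coords c p) $ j $ k - kronecker l j * g c (coords c p) $ i $ k))"
    if c: "c \<in> \<A>" "p \<in> chart_dom c" for c p
  proof -
    have p: "p \<in> E t" using Et charts c by blast
    obtain W t' where W: "p \<in> W" "t' \<noteq> 0"
      "\<And>r. r \<in> W \<Longrightarrow> B c (coords c r) = (- (?m * t')) *\<^sub>R A c (coords c r)"
      "\<And>r j k. r \<in> W \<Longrightarrow> ricci (g c) (coords c r) $ j $ k = ?m * t' * g c (coords c r) $ j $ k"
      "\<And>r l k i j. r \<in> W \<Longrightarrow> riemann (g c) (coords c r) l k i j
       = 2 * t' * (kronecker l i * g c (coords c r) $ j $ k - kronecker l j * g c (coords c r) $ i $ k)"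
      using local[OF _ _ c] by metis
    have "t' = t" using unique[OF _ p] E_iff[OF c] W by blast
    then show ?thesis using W by blast
  qed
  have "einstein \<A> g"
    unfolding einstein_def using main by blast
  moreover have "constant_sectional_curvature \<A> g (2 * t)"
    unfolding constant_sectional_curvature_def
  proof (intro ballI allI impI)
    fix c p u v assume c: "c \<in> \<A>" "p \<in> chart_dom c" and uv: "nondegenerate_plane (g c) (coords c p) u v"
    have "transpose (g c (coords c p)) = g c (coords c p)"
      using assms(3) c unfolding pseudo_riemannian_manifold_def pseudo_riemannian_metric_def by blast
    then show "sectional_curvature (g c) (coords c p) u v = 2 * t"
      using main[OF c] uv by (intro sectional_curvature_constant) auto
  qed
  moreover have "t \<noteq> 0" using main charts \<open>p0 \<in> topspace X\<close> by blast
  ultimately show ?thesis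
    using assms(3) unfolding de_sitter_def anti_de_sitter_def by (cases "t > 0") (auto intro!: exI[of _ "2 * t"])
qed

end
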